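(* Let $m\le M$, $n\le N$ be positive integers, $1\le p,q\le\infty$, $A=(a_{ij})_{i\le M,j\le N}$ a real matrix, and let $X=(X_{ij})_{i\le M,j\le N}$ have independent mean-zero entries taking values in $[-1,1]$. Then $$\mathbb{E}\sup_{I,J}\|X_A\colon\ell_p^J\to\ell_q^I\|=\mathbb{E}\sup_{I,J}\sup_{x\in B_p^J}\sup_{y\in B_{q^*}^I}\sum_{i\in I}\sum_{j\in J}y_ia_{ij}X_{ij}x_j$$ $$\le\ln(en)^{1/p^*}\ln(em)^{1/q}\Big[\big(2.4\sqrt{2\pi}\sqrt{\ln(mn)}+8\sqrt{2\pi}\sqrt{\ln M}+2\big)\sup_{I,J}\|A\circ A\colon\ell^J_{p/2}\to\ell^I_{q/2}\|^{1/2}+\big(8\sqrt{2\pi}\sqrt{\ln N}+4\big)\sup_{I,J}\|(A\circ A)^T\colon\ell^I_{q^*/2}\to\ell^J_{p^*/2}\|^{1/2}\Big],$$ where the suprema are over all $I\subset\{1,\dots,M\}$, $J\subset\{1,\dots,N\}$ with $|I|=m$, $|J|=n$.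
   Context: For nonempty $J$ and $0<s\le\infty$, $\ell_s^J$ is $\mathbb{R}^J$ with $\|x\|=(\sum_{j\in J}|x_j|^s)^{1/s}$ (max for $s=\infty$), $B_s^J$ its unit ball, and $\|B\colon\ell_s^J\to\ell_t^I\|=\sup_{x\in B_s^J}\|((Bx)_i)_{i\in I}\|_{\ell_t^I}$ (restriction to coordinates $J$ followed by projection onto coordinates $I$). $X_A=(a_{ij}X_{ij})$, $A\circ A=(a_{ij}^2)$, $p^*$ Hölder conjugate of $p$. *)

theory Defs
  imports "HOL-Probability.Probability"
begin

text \<open>Exponents s in (0, infinity] are represented as extended reals.
  The l_s^J (quasi-)norm of x restricted to the finite coordinate set J.\<close>
definition lnorm :: "ereal \<Rightarrow> nat set \<Rightarrow> (nat \<Rightarrow> real) \<Rightarrow> real" where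
  "lnorm s J x =
     (if s = \<infinity> then (if J = {} then 0 else Max ((\<lambda>j. \<bar>x j\<bar>) ` J))
      else (\<Sum>j\<in>J. \<bar>x j\<bar> powr real_of_ereal s) powr (1 / real_of_ereal s))"

definition lball :: "ereal \<Rightarrow> nat set \<Rightarrow> (nat \<Rightarrow> real) set" where
  "lball s J = {x. lnorm s J x \<le> 1}"

definition opnorm :: "(nat \<Rightarrow> nat \<Rightarrow> real) \<Rightarrow> ereal \<Rightarrow> ereal \<Rightarrow> nat set \<Rightarrow> nat set \<Rightarrow> real" where
  "opnorm B s t J I = (SUP x\<in>lball s J. lnorm t I (\<lambda>i. \<Sum>j\<in>J. B i j * x j))"

definition hconj :: "ereal \<Rightarrow> ereal" where
  "hconj p = (if p = 1 then \<infinity> else if p = \<infinity> then 1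
              else ereal (real_of_ereal p / (real_of_ereal p - 1)))"

definition einv :: "ereal \<Rightarrow> real" where
  "einv s = (if s = \<infinity> then 0 else 1 / real_of_ereal s)"

end

theory Submission
  imports Defs
begin

text \<open>Replacing x and y by normalised sign vectors supported on subsets K and L costs only the two
  logarithmic factors: if all sums of the k largest entries of z are at most \<open>D * k powr (1 / p)\<close>,
  then the k-th largest entry is at most \<open>D / k powr (1 - 1 / p)\<close>, and the norm of z is controlled
  by a harmonic sum. For sign vectors, a Chevet-type bound is obtained without Gaussian comparison.
  A union bound over all sign patterns on all subrectangles shows that one random factor of
  bounded mean controls every signed sum over L and K by the square root of the sum of
  squared entries times \<open>card L * ln (4 M) + card K * ln (4 N)\<close>. The rectangle is then cut into
  dyadic levels of the row and column norms; on each piece the rows, or the columns, are of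
  comparable size, and the pieces sum geometrically to the mixed norms, which testing the
  entrywise squared operator on flat vectors bounds by its operator norms.\<close>

section \<open>Norms and their duality\<close>

text \<open>The suprema over I and J stand inside the expectation, so bounding one rectangle at a
  time is not enough. The random factor therefore depends neither on I and J nor on the signs:
  everything after its construction is an inequality at a fixed sample point, and a single
  expectation is taken at the end. Patterns are weighted by the size of their support, since equal
  weights on all patterns would cost order M + N even for a single entry. The resulting bound does
  not yet have the required form: with S the sum of squared entries,
  \<open>sqrt (card L * S)\<close> equals the sum of the row norms when these agree, but by
  Cauchy-Schwarz it is otherwise larger. This is the reason for cutting into levels first. The cut
  costs a factor 4 and the random factor 5/2 in mean, which gives
  \<open>10 * sqrt (ln (4 * M))\<close>. This is below the stated constant only for M at least 2, so
  a single row or column is treated apart.\<close>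

lemma ge1_ereal_cases [consumes 1, case_names infinite one finite]:
  fixes p :: ereal
  assumes "1 \<le> p"
  obtains "p = \<infinity>" | "p = 1" | r where "p = ereal r" "1 < r"
  using assms by (cases p) (auto simp: one_ereal_def le_less)

lemma lnorm_ereal: "lnorm (ereal r) J x = (\<Sum>j\<in>J. \<bar>x j\<bar> powr r) powr (1 / r)"
  by (simp add: lnorm_def)

lemma lnorm_one: "lnorm 1 J x = (\<Sum>j\<in>J. \<bar>x j\<bar>)"
  by (simp add: lnorm_def powr_one sum_nonneg)

lemma lnorm_infinity: "lnorm \<infinity> J x = (if J = {} then 0 else Max ((\<lambda>j. \<bar>x j\<bar>) ` J))"
  by (simp add: lnorm_def)

lemma lnorm_infinity_le:
  assumes "finite J" "0 \<le> c" "\<And>j. j \<in> J \<Longrightarrow> \<bar>x j\<bar> \<le> c"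
  shows "lnorm \<infinity> J x \<le> c"
  using assms by (auto simp: lnorm_infinity)

lemma abs_le_lnorm_infinity:
  assumes "finite J" "j \<in> J"
  shows "\<bar>x j\<bar> \<le> lnorm \<infinity> J x"
  using assms by (auto simp: lnorm_infinity)

lemma lnorm_nonneg: "finite J \<Longrightarrow> 0 \<le> lnorm s J x"
  using abs_le_lnorm_infinity[of J _ x]
  by (cases "J = {}") (auto simp: lnorm_def Max_ge_iff)

lemma lnorm_ereal_powr:
  assumes "0 < r"
  shows "lnorm (ereal r) J x powr r = (\<Sum>j\<in>J. \<bar>x j\<bar> powr r)"
  using assms by (simp add: lnorm_ereal powr_powr powr_one sum_nonneg)

lemma abs_le_lnorm:
  assumes "finite J" "j \<in> J" "0 < s"
  shows "\<bar>x j\<bar> \<le> lnorm s J x"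
proof (cases s)
  case (real r)
  then have r: "0 < r" using assms by simp
  have "\<bar>x j\<bar> powr r \<le> (\<Sum>j\<in>J. \<bar>x j\<bar> powr r)"
    using assms by (intro member_le_sum) auto
  then have "(\<bar>x j\<bar> powr r) powr (1/r) \<le> lnorm s J x"
    unfolding real lnorm_ereal using r by (intro powr_mono2) auto
  then show ?thesis using r by (simp add: powr_powr powr_one)
qed (use assms abs_le_lnorm_infinity in auto)

text \<open>Exponents such as \<open>p / 2\<close> may lie below 1, where \<open>lnorm\<close> is
  only a quasi-norm. Monotonicity and homogeneity hold for every positive exponent, and the
  arguments about these exponents rest on them instead of a triangle inequality.\<close>

lemma lnorm_mono:
  assumes "finite J" "0 < s" "\<And>j. j \<in> J \<Longrightarrow> \<bar>x j\<bar> \<le> \<bar>y j\<bar>" "K \<subseteq> J"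
  shows "lnorm s K x \<le> lnorm s J y"
proof (cases s)
  case (real r)
  then have r: "0 < r" using assms by simp
  have "(\<Sum>j\<in>K. \<bar>x j\<bar> powr r) \<le> (\<Sum>j\<in>K. \<bar>y j\<bar> powr r)"
    using assms r by (intro sum_mono powr_mono2) auto
  also have "\<dots> \<le> (\<Sum>j\<in>J. \<bar>y j\<bar> powr r)"
    using assms by (intro sum_mono2) auto
  finally show ?thesis
    unfolding real lnorm_ereal using r by (intro powr_mono2) (auto intro: sum_nonneg)
next
  case PInf
  have "finite K" using assms finite_subset by blast
  then show ?thesis
    using assms PInf
    by (auto intro!: lnorm_infinity_le lnorm_nonneg
             intro: order_trans[OF _ abs_le_lnorm_infinity] simp: subset_iff)
qed (use assms in auto)

lemma lnorm_scale:
  assumes "finite J" "0 < s" "0 \<le> c"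
  shows "lnorm s J (\<lambda>j. c * x j) = c * lnorm s J x"
proof (cases s)
  case (real r)
  then have r: "0 < r" using assms by simp
  have "(\<Sum>j\<in>J. \<bar>c * x j\<bar> powr r) = c powr r * (\<Sum>j\<in>J. \<bar>x j\<bar> powr r)"
    using assms by (simp add: abs_mult powr_mult sum_distrib_left)
  then show ?thesis
    unfolding real lnorm_ereal using r assms
    by (simp add: powr_mult sum_nonneg powr_powr powr_one)
next
  case PInf
  have "mono ((*) c)" using assms by (auto intro: monoI mult_left_mono)
  then show ?thesis
    using assms PInf
    by (auto simp: lnorm_infinity abs_mult mono_Max_commute[where f = "(*) c"] image_image)
qed (use assms in auto)

text \<open>This is the origin of the halved exponents: an l_q norm of row norms is the root of an
  l_(q/2) norm of row sums of squares.\<close>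

lemma lnorm_half_square:
  assumes "finite J" "0 < s" "\<And>j. j \<in> J \<Longrightarrow> 0 \<le> r j"
  shows "lnorm s J (\<lambda>j. sqrt (r j)) = sqrt (lnorm (s / 2) J r)"
proof (cases s)
  case (real t)
  then have t: "0 < t" using assms by simp
  have s2: "s / 2 = ereal (t / 2)" using real by (simp add: divide_ereal_def)
  have "(\<Sum>j\<in>J. \<bar>sqrt (r j)\<bar> powr t) = (\<Sum>j\<in>J. \<bar>r j\<bar> powr (t/2))"
    using assms by (intro sum.cong) (auto simp: powr_half_sqrt[symmetric] powr_powr)
  then show ?thesis
    unfolding s2 unfolding real lnorm_ereal using t
    by (simp add: powr_half_sqrt[symmetric] powr_powr sum_nonneg)
next
  case PInf
  then have "s / 2 = \<infinity>" by simp
  moreover have "mono sqrt" by (auto intro: monoI)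
  moreover have "(\<lambda>j. \<bar>sqrt (r j)\<bar>) ` J = sqrt ` (\<lambda>j. \<bar>r j\<bar>) ` J"
    using assms by (auto simp: image_image intro!: image_cong)
  ultimately show ?thesis
    using assms PInf by (auto simp: lnorm_infinity mono_Max_commute[where f = sqrt])
qed (use assms in auto)

lemma hconj_one [simp]: "hconj 1 = \<infinity>" and hconj_infinity [simp]: "hconj \<infinity> = 1"
  by (simp_all add: hconj_def)

lemma hconj_ereal: "1 < r \<Longrightarrow> hconj (ereal r) = ereal (r / (r - 1))"
  by (simp add: hconj_def one_ereal_def)

lemma hconj_hconj:
  assumes "1 \<le> p"
  shows "hconj (hconj p) = p"
  using assms
proof (cases p rule: ge1_ereal_cases)
  case (finite r)
  then have "1 < r / (r - 1)" by (simp add: field_simps)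
  then show ?thesis using finite by (simp add: hconj_ereal field_simps)
qed auto

lemma one_le_hconj:
  assumes "1 \<le> p"
  shows "1 \<le> hconj p"
  using assms
proof (cases p rule: ge1_ereal_cases)
  case (finite r)
  then have "1 < r / (r - 1)" by (simp add: field_simps)
  then show ?thesis using finite by (simp add: hconj_ereal one_ereal_def)
qed auto

lemma einv_hconj:
  assumes "1 \<le> p"
  shows "einv (hconj p) = 1 - einv p"
  using assms
proof (cases p rule: ge1_ereal_cases)
  case (finite r)
  then show ?thesis by (simp add: hconj_ereal einv_def field_simps)
qed (auto simp: einv_def)

lemma lnorm_Hoelder:
  assumes "finite J" "1 \<le> p"
  shows "(\<Sum>j\<in>J. \<bar>x j\<bar> * \<bar>w j\<bar>) \<le> lnorm p J x * lnorm (hconj p) J w"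
  using \<open>1 \<le> p\<close>
proof (cases p rule: ge1_ereal_cases)
  case infinite
  have "(\<Sum>j\<in>J. \<bar>x j\<bar> * \<bar>w j\<bar>) \<le> (\<Sum>j\<in>J. lnorm \<infinity> J x * \<bar>w j\<bar>)"
    using assms by (intro sum_mono mult_right_mono abs_le_lnorm_infinity) auto
  then show ?thesis using infinite by (simp add: lnorm_one sum_distrib_left)
next
  case one
  have "(\<Sum>j\<in>J. \<bar>x j\<bar> * \<bar>w j\<bar>) \<le> (\<Sum>j\<in>J. \<bar>x j\<bar> * lnorm \<infinity> J w)"
    using assms by (intro sum_mono mult_left_mono abs_le_lnorm_infinity) auto
  then show ?thesis using one by (simp add: lnorm_one sum_distrib_right)
next
  case (finite r)
  define s where "s = r / (r - 1)"
  have s: "1 < s" "1 / r + 1 / s = 1" using finite by (auto simp: s_def field_simps)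
  define a where "a = lnorm p J x"
  define b where "b = lnorm (hconj p) J w"
  have hp: "hconj p = ereal s" using finite by (simp add: hconj_ereal s_def)
  have ar: "a powr r = (\<Sum>j\<in>J. \<bar>x j\<bar> powr r)" and bs: "b powr s = (\<Sum>j\<in>J. \<bar>w j\<bar> powr s)"
    using finite(2) s(1) by (simp_all add: a_def b_def hp, simp_all add: finite(1) lnorm_ereal_powr)
  have xa: "\<bar>x j\<bar> \<le> a" and wb: "\<bar>w j\<bar> \<le> b" if "j \<in> J" for j
    using assms that finite s unfolding a_def b_def hp by (auto intro!: abs_le_lnorm)
  have "a \<ge> 0" "b \<ge> 0" using assms by (auto simp: a_def b_def lnorm_nonneg)
  show ?thesis
  proof (cases "a = 0 \<or> b = 0")
    case True
    then have "\<bar>x j\<bar> * \<bar>w j\<bar> = 0" if "j \<in> J" for j using xa wb that by force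
    then have "(\<Sum>j\<in>J. \<bar>x j\<bar> * \<bar>w j\<bar>) = 0" by (intro sum.neutral) blast
    then show ?thesis using True by (auto simp: a_def[symmetric] b_def[symmetric])
  next
    case False
    then have ab: "a > 0" "b > 0" using \<open>a \<ge> 0\<close> \<open>b \<ge> 0\<close> by auto
    \<comment> \<open>Both vectors are normalised, so Young's inequality sums to
      \<open>1 / r + 1 / s = 1\<close>.\<close>
    have "(\<Sum>j\<in>J. (\<bar>x j\<bar> / a) * (\<bar>w j\<bar> / b))
        \<le> (\<Sum>j\<in>J. (\<bar>x j\<bar> / a) powr r / r + (\<bar>w j\<bar> / b) powr s / s)"
      using finite s ab by (intro sum_mono Youngs_inequality) auto
    also have "\<dots> = (\<Sum>j\<in>J. \<bar>x j\<bar> powr r) / a powr r / r + (\<Sum>j\<in>J. \<bar>w j\<bar> powr s) / b powr s / s"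
      using ab by (simp add: sum.distrib powr_divide sum_divide_distrib)
    also have "\<dots> = 1" using ab s by (simp flip: ar bs)
    finally have "(\<Sum>j\<in>J. \<bar>x j\<bar> * \<bar>w j\<bar>) / (a * b) \<le> 1"
      by (simp add: sum_divide_distrib)
    then show ?thesis using ab by (simp add: a_def[symmetric] b_def[symmetric])
  qed
qed

lemma lnorm_dual_attained:
  assumes "finite I" "1 \<le> q"
  shows "\<exists>y\<in>lball (hconj q) I. (\<Sum>i\<in>I. y i * z i) = lnorm q I z"
  using \<open>1 \<le> q\<close>
proof (cases q rule: ge1_ereal_cases)
  case infinite
  show ?thesis
  proof (cases "I = {}")
    case True
    then show ?thesis by (auto simp: infinite lball_def lnorm_one lnorm_infinity intro!: exI[of _ "\<lambda>_. 0"])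
  next
    case False
    then obtain i where i: "i \<in> I" "lnorm \<infinity> I z = \<bar>z i\<bar>"
      using Max_in[of "(\<lambda>j. \<bar>z j\<bar>) ` I"] assms by (auto simp: lnorm_infinity image_iff)
    define y where "y = (\<lambda>k. if k = i then sgn (z i) else 0)"
    have "(\<Sum>k\<in>I. \<bar>y k\<bar>) = \<bar>sgn (z i)\<bar>"
      using i assms by (simp add: y_def if_distrib[of abs] sum.delta cong: if_cong)
    moreover have "(\<Sum>k\<in>I. y k * z k) = sgn (z i) * z i"
      using i assms by (simp add: y_def if_distrib[of "\<lambda>a. a * _"] sum.delta cong: if_cong)
    ultimately have "y \<in> lball 1 I" "(\<Sum>k\<in>I. y k * z k) = lnorm q I z"
      using i infinite by (auto simp: lball_def lnorm_one abs_sgn_eq mult.commute[of "sgn _"] simp flip: abs_sgn)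
    then show ?thesis using infinite by auto
  qed
next
  case one
  have "(\<lambda>i. sgn (z i)) \<in> lball \<infinity> I"
    using assms by (auto simp: lball_def abs_sgn_eq intro!: lnorm_infinity_le)
  moreover have "(\<Sum>i\<in>I. sgn (z i) * z i) = lnorm 1 I z"
    by (simp add: lnorm_one mult.commute[of "sgn _"] flip: abs_sgn)
  ultimately show ?thesis using one by auto
next
  case (finite r)
  define s where "s = r / (r - 1)"
  have s: "1 < s" "(r - 1) * s = r" "r / s = r - 1" using finite by (auto simp: s_def field_simps)
  have hq: "hconj q = ereal s" using finite by (simp add: hconj_ereal s_def)
  define b where "b = lnorm q I z"
  have br: "b powr r = (\<Sum>j\<in>I. \<bar>z j\<bar> powr r)"
    using finite by (simp_all add: b_def lnorm_ereal_powr)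
  have b0: "b \<ge> 0" using assms by (simp add: b_def lnorm_nonneg)
  \<comment> \<open>The equality case of Hoelder: since \<open>(r - 1) * s = r\<close>, the s-th
    powers of y are the r-th powers of z divided by their sum.\<close>
  define y where "y = (\<lambda>i. sgn (z i) * (\<bar>z i\<bar> powr (r - 1) / b powr (r - 1)))"
  show ?thesis
  proof (cases "b = 0")
    case True
    then show ?thesis using s
      by (auto simp: hq lball_def lnorm_ereal b_def intro!: exI[of _ "\<lambda>_. 0"])
  next
    case False
    then have b: "b > 0" using b0 by simp
    have "\<bar>y i\<bar> powr s = \<bar>z i\<bar> powr r / b powr r" for i
      using b s finite by (auto simp: y_def abs_mult abs_sgn_eq powr_divide powr_powr)
    then have "(\<Sum>i\<in>I. \<bar>y i\<bar> powr s) = 1"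
      using b by (simp flip: sum_divide_distrib br)
    then have "y \<in> lball (hconj q) I"
      by (simp add: hq lball_def lnorm_ereal)
    moreover have "(\<Sum>i\<in>I. y i * z i) = b"
    proof -
      have "y i * z i = \<bar>z i\<bar> powr r / b powr (r - 1)" for i
      proof (cases "z i = 0")
        case False
        have "y i * z i = \<bar>z i\<bar> * \<bar>z i\<bar> powr (r - 1) / b powr (r - 1)"
          by (simp add: y_def abs_sgn)
        also have "\<bar>z i\<bar> * \<bar>z i\<bar> powr (r - 1) = \<bar>z i\<bar> powr r"
          using False by (simp add: powr_mult_base)
        finally show ?thesis .
      qed (simp add: y_def)
      then have "(\<Sum>i\<in>I. y i * z i) = b powr r / b powr (r - 1)"
        by (simp add: br flip: sum_divide_distrib)
      also have "\<dots> = b" using b by (simp flip: powr_diff)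
      finally show ?thesis .
    qed
    ultimately show ?thesis by (auto simp: b_def)
  qed
qed

text \<open>The supremum is attained, so it is a true maximum and the real \<open>SUP\<close> has a
  definite value. This produces the bilinear form of the operator norm.\<close>

lemma lnorm_eq_SUP:
  assumes "finite I" "1 \<le> q"
  shows "lnorm q I z = (SUP y\<in>lball (hconj q) I. \<Sum>i\<in>I. y i * z i)"
proof -
  obtain y where y: "y \<in> lball (hconj q) I" "(\<Sum>i\<in>I. y i * z i) = lnorm q I z"
    using lnorm_dual_attained[OF assms] by blast
  have "(\<Sum>i\<in>I. y i * z i) \<le> lnorm q I z" if "y \<in> lball (hconj q) I" for y
  proof -
    have "(\<Sum>i\<in>I. y i * z i) \<le> (\<Sum>i\<in>I. \<bar>y i\<bar> * \<bar>z i\<bar>)"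
      by (intro sum_mono) (simp flip: abs_mult)
    also have "\<dots> \<le> lnorm (hconj q) I y * lnorm q I z"
      using lnorm_Hoelder[OF assms(1) one_le_hconj[OF assms(2)], of y z] assms
      by (simp add: hconj_hconj)
    also have "\<dots> \<le> 1 * lnorm q I z"
      using that assms by (intro mult_right_mono lnorm_nonneg) (auto simp: lball_def)
    finally show ?thesis by simp
  qed
  with y show ?thesis
    by (intro cSup_eq_maximum[symmetric]) (auto intro!: image_eqI[of _ _ y])
qed

section \<open>Reduction to sign vectors on subsets\<close>

text \<open>Sorting is avoided by induction on the cardinality: the index removed minimises the
  modulus, so its entry is at most the average over I. Its r-th power is then at most
  \<open>D powr r / card I\<close>.\<close>

lemma sum_powr_flat:
  fixes z :: "nat \<Rightarrow> real"
  assumes "finite I" "I \<noteq> {}" "1 \<le> r" "0 \<le> D"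
    and "\<And>L. L \<subseteq> I \<Longrightarrow> L \<noteq> {} \<Longrightarrow> (\<Sum>i\<in>L. \<bar>z i\<bar>) \<le> D * real (card L) powr (1 - 1 / r)"
  shows "(\<Sum>i\<in>I. \<bar>z i\<bar> powr r) \<le> D powr r * (1 + ln (real (card I)))"
  using assms
proof (induction "card I" arbitrary: I)
  case (Suc k)
  have fin: "finite I" and ne: "I \<noteq> {}" by fact+
  define c where "c = real (card I)"
  have c: "c \<ge> 1" "c > 0" unfolding c_def using Suc.hyps(2) by auto
  obtain i where i: "i \<in> I" "\<And>k. k \<in> I \<Longrightarrow> \<bar>z i\<bar> \<le> \<bar>z k\<bar>"
    using ex_min_if_finite[of "(\<lambda>i. \<bar>z i\<bar>) ` I"] fin ne by (fastforce simp: not_less)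
  have "c * \<bar>z i\<bar> = (\<Sum>k\<in>I. \<bar>z i\<bar>)" by (simp add: c_def)
  also have "\<dots> \<le> (\<Sum>k\<in>I. \<bar>z k\<bar>)" using i by (intro sum_mono)
  also have "\<dots> \<le> D * c powr (1 - 1 / r)" unfolding c_def using Suc.prems(5)[of I] ne by simp
  also have "\<dots> = c * (D * c powr (- 1 / r))" using c by (simp add: powr_diff powr_minus field_simps)
  finally have "\<bar>z i\<bar> \<le> D * c powr (- 1 / r)" using c by simp
  then have "\<bar>z i\<bar> powr r \<le> (D * c powr (- 1 / r)) powr r"
    using Suc.prems by (intro powr_mono2) auto
  also have "\<dots> = D powr r * (1 / c)"
  proof -
    have "(c powr (- 1 / r)) powr r = 1 / c"
    proof -
      have "(c powr (- 1 / r)) powr r = c powr (- 1)" using Suc.prems by (simp add: powr_powr)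
      then show ?thesis using c by (simp add: powr_minus field_simps)
    qed
    then show ?thesis using Suc.prems by (simp add: powr_mult)
  qed
  finally have zi: "\<bar>z i\<bar> powr r \<le> D powr r * (1 / c)" .
  have split: "(\<Sum>i\<in>I. \<bar>z i\<bar> powr r) = \<bar>z i\<bar> powr r + (\<Sum>i\<in>I - {i}. \<bar>z i\<bar> powr r)"
    using fin i by (simp add: sum.remove)
  have card': "k = card (I - {i})" using Suc.hyps fin i by simp
  show ?case
  proof (cases "I - {i} = {}")
    case True
    then have "I = {i}" using i by blast
    then show ?thesis using zi split by (simp add: c_def)
  next
    case False
    have IH: "(\<Sum>i\<in>I - {i}. \<bar>z i\<bar> powr r) \<le> D powr r * (1 + ln (real (card (I - {i}))))"
      by (rule Suc.hyps(1)[OF card']) (use Suc.prems False in auto)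
    have c1: "real (card (I - {i})) = c - 1" "c > 1"
      using fin i False card' Suc.hyps(2) card_gt_0_iff[of "I - {i}"]
      by (auto simp: c_def)
    \<comment> \<open>The harmonic sum is compared with the logarithm term by term, so that the
      bounds telescope. The singleton was split off because c = 1 would put 0 inside the
      logarithm.\<close>
    have "1 / c \<le> ln c - ln (c - 1)"
      using ln_le_minus_one[of "(c - 1) / c"] c1 by (simp add: ln_div field_simps)
    then have "D powr r * (1 / c) + D powr r * (1 + ln (c - 1)) \<le> D powr r * (1 + ln c)"
      by (subst distrib_left[symmetric], intro mult_left_mono) auto
    then show ?thesis using zi IH split c1 by (simp add: c_def)
  qed
qed simp

text \<open>The k-th largest entry of z is at most the average of the k largest ones, hence at most
  \<open>D / k powr (1 / q)\<close>; the logarithm is the harmonic sum.\<close>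
lemma lnorm_flat:
  fixes z :: "nat \<Rightarrow> real"
  assumes "finite I" "I \<noteq> {}" "1 \<le> q" "0 \<le> D"
    and "\<And>L. L \<subseteq> I \<Longrightarrow> L \<noteq> {} \<Longrightarrow> (\<Sum>i\<in>L. \<bar>z i\<bar>) \<le> D * real (card L) powr (1 - einv q)"
  shows "lnorm q I z \<le> ln (exp 1 * real (card I)) powr einv q * D"
proof -
  have "card I > 0" using assms by (simp add: card_gt_0_iff)
  then have L: "ln (exp 1 * real (card I)) = 1 + ln (real (card I))" "ln (real (card I)) \<ge> 0"
    by (auto simp: ln_mult)
  show ?thesis
  proof (cases q)
    case PInf
    have "\<bar>z i\<bar> \<le> D" if "i \<in> I" for i
      using assms(5)[of "{i}"] that PInf by (simp add: einv_def)
    then show ?thesis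
      using assms L PInf by (auto simp: einv_def intro!: lnorm_infinity_le)
  next
    case (real r)
    then have r: "r \<ge> 1" "einv q = 1 / r" using assms by (auto simp: einv_def one_ereal_def)
    have "lnorm q I z = (\<Sum>i\<in>I. \<bar>z i\<bar> powr r) powr (1 / r)" by (simp add: real lnorm_ereal)
    also have "\<dots> \<le> (D powr r * (1 + ln (real (card I)))) powr (1 / r)"
      using r assms sum_powr_flat[of I r D z] by (intro powr_mono2) (auto intro: sum_nonneg)
    also have "\<dots> = ln (exp 1 * real (card I)) powr einv q * D"
      using r L assms by (simp add: powr_mult powr_powr)
    finally show ?thesis .
  qed (use assms in auto)
qed

text \<open>\<open>lnorm_flat\<close> is used twice, each time at the price of one logarithmic
  factor. For fixed L, it bounds the signed column sums w in the conjugate exponent of p, and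
  Hoelder against x then makes the image of x flat on L. The second use bounds that image in
  exponent q.\<close>

lemma opnorm_flat:
  fixes B :: "nat \<Rightarrow> nat \<Rightarrow> real"
  assumes fin: "finite I" "I \<noteq> {}" "finite J" "J \<noteq> {}" and pq: "1 \<le> p" "1 \<le> q" and "0 \<le> D"
    and D: "\<And>L K \<eta> \<epsilon>. L \<subseteq> I \<Longrightarrow> L \<noteq> {} \<Longrightarrow> K \<subseteq> J \<Longrightarrow> K \<noteq> {} \<Longrightarrow>
       (\<And>i. \<eta> i = 1 \<or> \<eta> i = -1) \<Longrightarrow> (\<And>j. \<epsilon> j = 1 \<or> \<epsilon> j = -1) \<Longrightarrow>
       (\<Sum>i\<in>L. \<Sum>j\<in>K. \<eta> i * \<epsilon> j * B i j)
         \<le> D * real (card L) powr einv (hconj q) * real (card K) powr einv p"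
  shows "opnorm B p q J I
    \<le> ln (exp 1 * real (card J)) powr einv (hconj p) * ln (exp 1 * real (card I)) powr einv q * D"
  unfolding opnorm_def
proof (rule cSUP_least)
  have "(\<lambda>_. 0) \<in> lball p J"
    using fin pq by (auto simp: lball_def lnorm_def)
  then show "lball p J \<noteq> {}" by blast
next
  fix x assume x: "x \<in> lball p J"
  let ?z = "\<lambda>i. \<Sum>j\<in>J. B i j * x j"
  define D1 where "D1 = ln (exp 1 * real (card J)) powr einv (hconj p) * D"
  have D1: "D1 \<ge> 0" using \<open>0 \<le> D\<close> by (simp add: D1_def)
  have "(\<Sum>i\<in>L. \<bar>?z i\<bar>) \<le> D1 * real (card L) powr (1 - einv q)"
    if L: "L \<subseteq> I" "L \<noteq> {}" for L
  proof -
    \<comment> \<open>The signs of the image linearise its absolute values, so the sums can be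
      exchanged and x is paired with w.\<close>
    define \<eta> :: "nat \<Rightarrow> real" where "\<eta> i = (if ?z i \<ge> 0 then 1 else -1)" for i
    have \<eta>: "\<eta> i = 1 \<or> \<eta> i = -1" for i by (simp add: \<eta>_def)
    define w where "w j = (\<Sum>i\<in>L. \<eta> i * B i j)" for j
    have "lnorm (hconj p) J w
        \<le> ln (exp 1 * real (card J)) powr einv (hconj p) * (D * real (card L) powr einv (hconj q))"
    proof (rule lnorm_flat[OF fin(3,4) one_le_hconj[OF pq(1)]])
      fix K assume K: "K \<subseteq> J" "K \<noteq> {}"
      define \<epsilon> :: "nat \<Rightarrow> real" where "\<epsilon> j = (if w j \<ge> 0 then 1 else -1)" for j
      have \<epsilon>: "\<epsilon> j = 1 \<or> \<epsilon> j = -1" for j by (simp add: \<epsilon>_def)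
      have "(\<Sum>j\<in>K. \<bar>w j\<bar>) = (\<Sum>j\<in>K. \<Sum>i\<in>L. \<eta> i * \<epsilon> j * B i j)"
        by (intro sum.cong refl) (auto simp: \<epsilon>_def w_def sum_distrib_left sum_negf mult_ac)
      also have "\<dots> = (\<Sum>i\<in>L. \<Sum>j\<in>K. \<eta> i * \<epsilon> j * B i j)" by (rule sum.swap)
      also have "\<dots> \<le> D * real (card L) powr einv (hconj q) * real (card K) powr einv p"
        by (intro D L K \<eta> \<epsilon>)
      finally show "(\<Sum>j\<in>K. \<bar>w j\<bar>) \<le> D * real (card L) powr einv (hconj q)
          * real (card K) powr (1 - einv (hconj p))"
        using pq by (simp add: einv_hconj)
    qed (use \<open>0 \<le> D\<close> in auto)
    then have w: "lnorm (hconj p) J w \<le> D1 * real (card L) powr (1 - einv q)"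
      using pq by (simp add: D1_def einv_hconj mult_ac)
    have "(\<Sum>i\<in>L. \<bar>?z i\<bar>) = (\<Sum>i\<in>L. \<Sum>j\<in>J. \<eta> i * B i j * x j)"
      by (intro sum.cong refl) (auto simp: \<eta>_def sum_distrib_left sum_negf mult_ac)
    also have "\<dots> = (\<Sum>j\<in>J. x j * w j)"
      by (subst sum.swap) (simp add: w_def sum_distrib_left mult_ac)
    also have "\<dots> \<le> (\<Sum>j\<in>J. \<bar>x j\<bar> * \<bar>w j\<bar>)"
      by (intro sum_mono) (simp flip: abs_mult)
    also have "\<dots> \<le> lnorm p J x * lnorm (hconj p) J w"
      using fin pq by (intro lnorm_Hoelder) auto
    also have "\<dots> \<le> 1 * lnorm (hconj p) J w"
      using x fin by (intro mult_right_mono lnorm_nonneg) (auto simp: lball_def)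
    finally show ?thesis using w by simp
  qed
  then have "lnorm q I ?z \<le> ln (exp 1 * real (card I)) powr einv q * D1"
    using fin pq D1 by (intro lnorm_flat) auto
  then show "lnorm q I ?z \<le> ln (exp 1 * real (card J)) powr einv (hconj p)
      * ln (exp 1 * real (card I)) powr einv q * D"
    by (simp add: D1_def mult_ac)
qed

section \<open>Operator norms of the squared matrix\<close>

text \<open>Without boundedness the real supremum \<open>opnorm\<close> would not dominate its test
  values. Coordinates of a point of the ball have modulus at most 1 for every positive exponent,
  which bounds the image entrywise.\<close>

lemma bdd_above_opnorm:
  assumes "finite I" "finite J" "0 < s" "0 < t"
  shows "bdd_above ((\<lambda>x. lnorm t I (\<lambda>i. \<Sum>j\<in>J. B i j * x j)) ` lball s J)"
proof (rule bdd_aboveI2)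
  fix x assume x: "x \<in> lball s J"
  have "\<bar>\<Sum>j\<in>J. B i j * x j\<bar> \<le> \<bar>\<Sum>j\<in>J. \<bar>B i j\<bar>\<bar>" for i
  proof -
    have "\<bar>\<Sum>j\<in>J. B i j * x j\<bar> \<le> (\<Sum>j\<in>J. \<bar>B i j * x j\<bar>)" by (rule sum_abs)
    also have "\<dots> \<le> (\<Sum>j\<in>J. \<bar>B i j\<bar>)"
    proof (rule sum_mono)
      fix j assume "j \<in> J"
      then have "\<bar>x j\<bar> \<le> 1" using abs_le_lnorm[of J j s x] assms x by (auto simp: lball_def)
      then show "\<bar>B i j * x j\<bar> \<le> \<bar>B i j\<bar>" by (simp add: abs_mult mult_left_le)
    qed
    finally show ?thesis by simp
  qed
  then show "lnorm t I (\<lambda>i. \<Sum>j\<in>J. B i j * x j) \<le> lnorm t I (\<lambda>i. \<Sum>j\<in>J. \<bar>B i j\<bar>)"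
    using assms by (intro lnorm_mono) auto
qed

text \<open>Test the operator on \<open>k powr (- 2 / p)\<close> times the indicator of K.\<close>
lemma sum_sqrt_rows_le_opnorm:
  fixes A :: "nat \<Rightarrow> nat \<Rightarrow> real"
  assumes fin: "finite I" "finite J" and pq: "1 \<le> p" "1 \<le> q"
    and L: "L \<subseteq> I" "L \<noteq> {}" and K: "K \<subseteq> J" "K \<noteq> {}"
  shows "(\<Sum>i\<in>L. sqrt (\<Sum>j\<in>K. (A i j)\<^sup>2))
    \<le> sqrt (opnorm (\<lambda>i j. (A i j)\<^sup>2) (p / 2) (q / 2) J I)
        * real (card L) powr einv (hconj q) * real (card K) powr einv p"
proof -
  have finLK: "finite L" "finite K" using fin L K finite_subset by blast+
  define k where "k = real (card K)"
  define l where "l = real (card L)"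
  have k: "k > 0" and l: "l > 0" using finLK L K by (auto simp: k_def l_def card_gt_0_iff)
  have p2: "0 < p / 2" and q2: "0 < q / 2" and q0: "0 < q"
    using pq by (cases p; cases q; simp add: one_ereal_def)+
  define r where "r i = (\<Sum>j\<in>K. (A i j)\<^sup>2)" for i
  have r0: "r i \<ge> 0" for i by (simp add: r_def sum_nonneg)
  \<comment> \<open>The exponent is fixed by \<open>k * c powr (p / 2) = 1\<close>, which puts x
    into the unit ball. For infinite p, \<open>einv p = 0\<close> and c is 1.\<close>
  define c where "c = k powr (- 2 * einv p)"
  have c: "c > 0" using k by (simp add: c_def)
  define x where "x j = (if j \<in> K then c else 0)" for j
  have Bx: "(\<Sum>j\<in>J. (A i j)\<^sup>2 * x j) = c * r i" for i
  proof -
    have "(\<Sum>j\<in>J. (A i j)\<^sup>2 * x j) = (\<Sum>j\<in>K. (A i j)\<^sup>2 * x j)"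
      using fin K by (intro sum.mono_neutral_right) (auto simp: x_def)
    then show ?thesis by (simp add: x_def r_def sum_distrib_left mult_ac)
  qed
  have "lnorm (p / 2) J x \<le> 1"
  proof (cases p)
    case PInf
    then show ?thesis using fin c k by (auto simp: x_def c_def einv_def intro!: lnorm_infinity_le)
  next
    case (real t)
    then have t: "t \<ge> 1" "einv p = 1 / t" "p / 2 = ereal (t / 2)"
      using pq by (auto simp: einv_def one_ereal_def divide_ereal_def)
    have "(\<Sum>j\<in>J. \<bar>x j\<bar> powr (t / 2)) = (\<Sum>j\<in>K. c powr (t / 2))"
      using fin K c t by (intro sum.mono_neutral_cong_right) (auto simp: x_def)
    also have "\<dots> = k * c powr (t / 2)" by (simp add: k_def)
    also have "c powr (t / 2) = k powr (- 1)" using t by (simp add: c_def powr_powr)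
    also have "k * k powr (- 1) = 1" using k by (simp add: powr_minus)
    finally show ?thesis using k t by (simp add: lnorm_ereal)
  qed (use pq in auto)
  then have "lnorm (q / 2) I (\<lambda>i. \<Sum>j\<in>J. (A i j)\<^sup>2 * x j)
      \<le> opnorm (\<lambda>i j. (A i j)\<^sup>2) (p / 2) (q / 2) J I"
    unfolding opnorm_def using fin p2 q2
    by (intro cSUP_upper bdd_above_opnorm) (auto simp: lball_def)
  moreover have "lnorm (q / 2) L (\<lambda>i. c * r i) \<le> lnorm (q / 2) I (\<lambda>i. c * r i)"
    using fin q2 L by (intro lnorm_mono) auto
  ultimately have *: "c * lnorm (q / 2) L r \<le> opnorm (\<lambda>i j. (A i j)\<^sup>2) (p / 2) (q / 2) J I"
    using c finLK q2 by (simp add: Bx lnorm_scale)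
  have "(\<Sum>i\<in>L. sqrt (r i)) = (\<Sum>i\<in>L. \<bar>sqrt (r i)\<bar> * \<bar>1\<bar>)" by (simp add: r0)
  also have "\<dots> \<le> lnorm q L (\<lambda>i. sqrt (r i)) * lnorm (hconj q) L (\<lambda>_. 1)"
    using finLK pq by (intro lnorm_Hoelder) auto
  also have "lnorm (hconj q) L (\<lambda>_. 1) = l powr einv (hconj q)"
    using L l by (simp add: lnorm_def einv_def l_def image_constant_conv)
  also have "lnorm q L (\<lambda>i. sqrt (r i)) = sqrt (lnorm (q / 2) L r)"
    using finLK q0 r0 by (intro lnorm_half_square)
  \<comment> \<open>Undoing the normalisation of the test vector produces exactly the factor
    \<open>k powr einv p\<close>.\<close>
  also have "\<dots> = sqrt (c * lnorm (q / 2) L r) * k powr einv p"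
  proof -
    have "sqrt (1 / c) = k powr einv p"
    proof -
      have "1 / c = (k powr einv p)\<^sup>2"
        by (simp add: c_def powr_minus_divide power2_eq_square flip: powr_add)
      then show ?thesis by simp
    qed
    then show ?thesis using c k by (simp add: real_sqrt_mult real_sqrt_divide field_simps)
  qed
  also have "\<dots> \<le> sqrt (opnorm (\<lambda>i j. (A i j)\<^sup>2) (p / 2) (q / 2) J I) * k powr einv p"
    using * by (intro mult_right_mono) auto
  finally show ?thesis
    using l by (simp add: r_def k_def l_def mult_ac)
qed

section \<open>Subgaussian rectangles\<close>

text \<open>Levels are integers of either sign. The distance \<open>g - s\<close> below the top
  sends them injectively to naturals, and the full geometric series bounds the sum.\<close>

lemma sum_powr_two_atMost:
  fixes F :: "int set"
  assumes "finite F" "\<And>s. s \<in> F \<Longrightarrow> s \<le> g"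
  shows "(\<Sum>s\<in>F. 2 powr real_of_int s) \<le> 2 * 2 powr real_of_int g"
proof -
  define h where "h s = nat (g - s)" for s
  have int_h: "int (h s) = g - s" if "s \<in> F" for s
    using assms(2)[OF that] by (simp add: h_def)
  have inj: "inj_on h F"
  proof (rule inj_onI)
    fix s t assume st: "s \<in> F" "t \<in> F" "h s = h t"
    have "g - s = g - t" using int_h[OF st(1)] int_h[OF st(2)] st(3) by metis
    then show "s = t" by simp
  qed
  have eq: "2 powr real_of_int s = 2 powr real_of_int g * (1 / 2) ^ h s" if "s \<in> F" for s
  proof -
    have "(1 / 2 :: real) ^ h s = 2 powr (- real (h s))"
      by (simp add: powr_minus_divide powr_realpow power_one_over)
    also have "- real (h s) = real_of_int s - real_of_int g"
      using int_h[OF that] by (metis of_int_diff of_int_of_nat_eq minus_diff_eq)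
    finally show ?thesis by (simp flip: powr_add)
  qed
  have "(\<Sum>s\<in>F. 2 powr real_of_int s) = 2 powr real_of_int g * (\<Sum>s\<in>F. (1 / 2) ^ h s)"
    unfolding sum_distrib_left using eq by (intro sum.cong) auto
  also have "(\<Sum>s\<in>F. (1 / 2 :: real) ^ h s) = (\<Sum>k\<in>h ` F. (1 / 2) ^ k)"
    by (simp add: sum.reindex[OF inj])
  also have "\<dots> \<le> (\<Sum>k. (1 / 2) ^ k)"
    using assms by (intro sum_le_suminf) (auto intro: summable_geometric)
  also have "\<dots> = 2" by (simp add: suminf_geometric)
  finally show ?thesis by (simp add: mult_ac)
qed

text \<open>Within a dyadic level of the rows the entries are comparable, so the subgaussian cost of
  the level is the geometric mean of a row term and a column term; the column terms form
  geometric series because a column only meets the levels below its own.\<close>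
lemma dyadic_levels_bound:
  fixes x y :: "nat \<Rightarrow> real" and f g :: "nat \<Rightarrow> int" and S :: "int \<Rightarrow> real"
  assumes fin: "finite L" "finite K" and pos: "0 < \<alpha>" "0 < \<beta>"
    and S: "\<And>s. s \<in> f ` L \<Longrightarrow> S s \<le> (\<Sum>i\<in>{i\<in>L. f i = s}. \<alpha> * (x i)\<^sup>2)"
    and f: "\<And>i. i \<in> L \<Longrightarrow> 2 powr f i \<le> x i \<and> x i \<le> 2 * 2 powr f i"
    and g: "\<And>j. j \<in> K \<Longrightarrow> 2 powr g j \<le> y j"
    and G: "\<And>s. s \<in> f ` L \<Longrightarrow> G s \<subseteq> {j\<in>K. s \<le> g j}"
  shows "(\<Sum>s\<in>f ` L. sqrt (S s * (real (card {i\<in>L. f i = s}) * \<alpha> + real (card (G s)) * \<beta>)))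
     \<le> 2 * (\<Sum>i\<in>L. \<alpha> * x i) + 2 * (\<Sum>j\<in>K. \<beta> * y j)"
proof -
  \<comment> \<open>\<open>T s\<close> is the weighted row mass of the level. \<open>U s\<close>
    charges each column met there at the scale \<open>2 powr s\<close> of the level, not at its own
    y j, so that summing over levels is a geometric series.\<close>
  define T where "T s = (\<Sum>i\<in>{i\<in>L. f i = s}. \<alpha> * x i)" for s
  define U where "U s = real (card (G s)) * \<beta> * 2 powr s" for s :: int
  have level: "sqrt (S s * (real (card {i\<in>L. f i = s}) * \<alpha> + real (card (G s)) * \<beta>)) \<le> 2 * T s + U s"
    if s: "s \<in> f ` L" for s
  proof -
    define \<tau> where "\<tau> = 2 powr real_of_int s"
    have \<tau>: "\<tau> > 0" by (simp add: \<tau>_def)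
    have x: "\<tau> \<le> x i" "x i \<le> 2 * \<tau>" if "i \<in> L" "f i = s" for i
      using f[of i] that by (auto simp: \<tau>_def)
    have T0: "T s \<ge> 0"
      unfolding T_def using x \<tau> pos by (intro sum_nonneg) (fastforce intro: mult_nonneg_nonneg)
    have U0: "U s \<ge> 0" unfolding U_def using pos by simp
    have "S s \<le> (\<Sum>i\<in>{i\<in>L. f i = s}. \<alpha> * (x i)\<^sup>2)" by (rule S[OF s])
    also have "\<dots> \<le> (\<Sum>i\<in>{i\<in>L. f i = s}. 2 * \<tau> * (\<alpha> * x i))"
    proof (intro sum_mono)
      fix i assume "i \<in> {i\<in>L. f i = s}"
      then have "\<tau> \<le> x i" "x i \<le> 2 * \<tau>" using x by auto
      then have "\<alpha> * x i * x i \<le> \<alpha> * x i * (2 * \<tau>)"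
        using pos \<tau> by (intro mult_left_mono) auto
      then show "\<alpha> * (x i)\<^sup>2 \<le> 2 * \<tau> * (\<alpha> * x i)" by (simp add: power2_eq_square mult_ac)
    qed
    also have "\<dots> = 2 * \<tau> * T s" by (simp add: T_def sum_distrib_left)
    finally have Ss: "S s \<le> 2 * \<tau> * T s" .
    have "real (card {i\<in>L. f i = s}) * \<alpha> * \<tau> = (\<Sum>i\<in>{i\<in>L. f i = s}. \<alpha> * \<tau>)" by simp
    also have "\<dots> \<le> T s" unfolding T_def using x pos by (intro sum_mono mult_left_mono) auto
    finally have C: "real (card {i\<in>L. f i = s}) * \<alpha> + real (card (G s)) * \<beta> \<le> (T s + U s) / \<tau>"
      using \<tau> by (simp add: U_def \<tau>_def[symmetric] field_simps)
    \<comment> \<open>The first factor carries \<open>\<tau>\<close> and the second its inverse, so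
      the scale cancels and the square root becomes linear in T and U.\<close>
    have "S s * (real (card {i\<in>L. f i = s}) * \<alpha> + real (card (G s)) * \<beta>)
        \<le> (2 * \<tau> * T s) * ((T s + U s) / \<tau>)"
      using Ss C \<tau> T0 U0 pos by (intro mult_mono) auto
    also have "\<dots> = 2 * T s * (T s + U s)" using \<tau> by simp
    also have "\<dots> \<le> (2 * T s + U s)\<^sup>2"
      using T0 U0 by (simp add: power2_eq_square algebra_simps)
    finally show ?thesis using T0 U0 by (intro real_le_lsqrt) auto
  qed
  have "(\<Sum>s\<in>f ` L. U s) \<le> (\<Sum>s\<in>f ` L. \<Sum>j\<in>{j\<in>K. s \<le> g j}. \<beta> * 2 powr s)"
  proof (rule sum_mono)
    fix s assume "s \<in> f ` L"
    then have "card (G s) \<le> card {j\<in>K. s \<le> g j}" using G fin by (intro card_mono) auto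
    then show "U s \<le> (\<Sum>j\<in>{j\<in>K. s \<le> g j}. \<beta> * 2 powr s)"
      using pos by (simp add: U_def mult_ac)
  qed
  also have "\<dots> = (\<Sum>j\<in>K. \<Sum>s\<in>{s\<in>f ` L. s \<le> g j}. \<beta> * 2 powr s)"
    using fin by (intro sum.swap_restrict) auto
  also have "\<dots> \<le> (\<Sum>j\<in>K. \<beta> * (2 * y j))"
  proof (rule sum_mono)
    fix j assume j: "j \<in> K"
    have "(\<Sum>s\<in>{s\<in>f ` L. s \<le> g j}. 2 powr real_of_int s) \<le> 2 * 2 powr g j"
      using fin by (intro sum_powr_two_atMost) auto
    also have "\<dots> \<le> 2 * y j" using g[OF j] by simp
    finally have "(\<Sum>s\<in>{s\<in>f ` L. s \<le> g j}. 2 powr real_of_int s) \<le> 2 * y j" .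
    then show "(\<Sum>s\<in>{s\<in>f ` L. s \<le> g j}. \<beta> * 2 powr s) \<le> \<beta> * (2 * y j)"
      unfolding sum_distrib_left[symmetric] using pos by (intro mult_left_mono) auto
  qed
  also have "\<dots> = 2 * (\<Sum>j\<in>K. \<beta> * y j)" by (simp add: sum_distrib_left mult_ac)
  finally have U: "(\<Sum>s\<in>f ` L. U s) \<le> 2 * (\<Sum>j\<in>K. \<beta> * y j)" .
  have "(\<Sum>s\<in>f ` L. T s) = (\<Sum>i\<in>L. \<alpha> * x i)"
    unfolding T_def by (rule sum.image_gen[OF fin(1), symmetric])
  moreover have "(\<Sum>s\<in>f ` L. sqrt (S s * (real (card {i\<in>L. f i = s}) * \<alpha> + real (card (G s)) * \<beta>)))
      \<le> (\<Sum>s\<in>f ` L. 2 * T s + U s)"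
    by (intro sum_mono level)
  ultimately show ?thesis using U by (simp only: sum.distrib flip: sum_distrib_left)
qed

lemma floor_log2_bounds:
  assumes "0 < x"
  shows "2 powr \<lfloor>log 2 x\<rfloor> \<le> x" "x \<le> 2 * 2 powr \<lfloor>log 2 x\<rfloor>"
proof -
  have "2 powr \<lfloor>log 2 x\<rfloor> \<le> 2 powr (log 2 x)" by (intro powr_mono) auto
  then show "2 powr \<lfloor>log 2 x\<rfloor> \<le> x" using assms by simp
  have "2 powr (log 2 x) \<le> 2 powr (1 + \<lfloor>log 2 x\<rfloor>)" by (intro powr_mono) linarith+
  then show "x \<le> 2 * 2 powr \<lfloor>log 2 x\<rfloor>" using assms by (simp add: powr_add)
qed

text \<open>Rows and columns are split into dyadic levels of \<open>sqrt (r i / \<alpha>)\<close> and \<open>sqrt (c j / \<beta>)\<close>, and an entry is charged to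
  the side with the smaller level.\<close>
lemma subrectangle_bounds_imp_Chevet:
  fixes A B :: "nat \<Rightarrow> nat \<Rightarrow> real"
  assumes fin: "finite L" "finite K" and pos: "0 < \<alpha>" "0 < \<beta>" and "0 \<le> Q"
    and Q: "\<And>L' K'. L' \<subseteq> L \<Longrightarrow> K' \<subseteq> K \<Longrightarrow> (\<Sum>i\<in>L'. \<Sum>j\<in>K'. B i j)
       \<le> Q * sqrt ((\<Sum>i\<in>L'. \<Sum>j\<in>K'. (A i j)\<^sup>2) * (real (card L') * \<alpha> + real (card K') * \<beta>))"
  shows "(\<Sum>i\<in>L. \<Sum>j\<in>K. B i j)
    \<le> 4 * Q * (sqrt \<alpha> * (\<Sum>i\<in>L. sqrt (\<Sum>j\<in>K. (A i j)\<^sup>2)) + sqrt \<beta> * (\<Sum>j\<in>K. sqrt (\<Sum>i\<in>L. (A i j)\<^sup>2)))"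
proof -
  define r where "r i = (\<Sum>j\<in>K. (A i j)\<^sup>2)" for i
  define c where "c j = (\<Sum>i\<in>L. (A i j)\<^sup>2)" for j
  have r0: "r i \<ge> 0" and c0: "c j \<ge> 0" for i j by (auto simp: r_def c_def sum_nonneg)
  \<comment> \<open>Zero rows and columns have no dyadic level and are removed first.\<close>
  define L1 where "L1 = {i\<in>L. r i > 0}"
  define K1 where "K1 = {j\<in>K. c j > 0}"
  have fin1: "finite L1" "finite K1" and sub: "L1 \<subseteq> L" "K1 \<subseteq> K"
    using fin by (auto simp: L1_def K1_def)
  \<comment> \<open>With this scaling \<open>\<alpha> * (x i)\<^sup>2\<close> is the row energy,
    while \<open>\<alpha> * x i\<close> is already the term wanted in the conclusion. Dividing by
    the respective costs makes row and column levels comparable.\<close>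
  define x where "x i = sqrt (r i / \<alpha>)" for i
  define y where "y j = sqrt (c j / \<beta>)" for j
  have x0: "x i > 0" if "i \<in> L1" for i using that pos by (auto simp: x_def L1_def)
  have y0: "y j > 0" if "j \<in> K1" for j using that pos by (auto simp: y_def K1_def)
  define f where "f i = \<lfloor>log 2 (x i)\<rfloor>" for i
  define g where "g j = \<lfloor>log 2 (y j)\<rfloor>" for j
  have x2: "\<alpha> * (x i)\<^sup>2 = r i" and y2: "\<beta> * (y j)\<^sup>2 = c j" for i j
    using pos r0[of i] c0[of j] by (auto simp: x_def y_def)
  have ax: "\<alpha> * x i = sqrt \<alpha> * sqrt (r i)" and by': "\<beta> * y j = sqrt \<beta> * sqrt (c j)" for i j
    using pos r0[of i] c0[of j] by (auto simp: x_def y_def real_sqrt_divide field_simps)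
  define V where "V = (\<Sum>i\<in>L. \<alpha> * x i)"
  define W where "W = (\<Sum>j\<in>K. \<beta> * y j)"
  have V1: "(\<Sum>i\<in>L1. \<alpha> * x i) \<le> V" and W1: "(\<Sum>j\<in>K1. \<beta> * y j) \<le> W"
    unfolding V_def W_def using fin sub pos r0 c0
    by (auto intro!: sum_mono2 simp: x_def y_def)
  \<comment> \<open>The hypothesis for a single cell with zero entry has right-hand side 0. Cells
    outside \<open>L1\<close> and \<open>K1\<close>, where A vanishes, may therefore be replaced by
    0.\<close>
  have nonpos: "B i j \<le> 0" if "i \<in> L" "j \<in> K" "A i j = 0" for i j
    using Q[of "{i}" "{j}"] that by simp
  have A0: "A i j = 0" if "i \<in> L" "j \<in> K" "\<not> (i \<in> L1 \<and> j \<in> K1)" for i j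
  proof -
    have "r i = 0 \<or> c j = 0" using that r0[of i] c0[of j] by (auto simp: L1_def K1_def)
    then show ?thesis
    proof
      assume "r i = 0"
      then show ?thesis using that fin by (auto simp: r_def sum_nonneg_eq_0_iff)
    next
      assume "c j = 0"
      then show ?thesis using that fin by (auto simp: c_def sum_nonneg_eq_0_iff)
    qed
  qed
  have "(\<Sum>i\<in>L. \<Sum>j\<in>K. B i j) \<le> (\<Sum>i\<in>L. \<Sum>j\<in>K. if i \<in> L1 \<and> j \<in> K1 then B i j else 0)"
    using nonpos A0 by (intro sum_mono) auto
  also have "\<dots> = (\<Sum>i\<in>L1. \<Sum>j\<in>K. if i \<in> L1 \<and> j \<in> K1 then B i j else 0)"
    using fin sub by (intro sum.mono_neutral_right) auto
  also have "\<dots> = (\<Sum>i\<in>L1. \<Sum>j\<in>K1. B i j)"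
  proof (rule sum.cong[OF refl])
    fix i assume "i \<in> L1"
    then show "(\<Sum>j\<in>K. if i \<in> L1 \<and> j \<in> K1 then B i j else 0) = (\<Sum>j\<in>K1. B i j)"
      using fin sub by (intro sum.mono_neutral_cong_right) auto
  qed
  \<comment> \<open>Ties go to the columns, so every cell is counted once. The columns left to a row
    depend on it only through \<open>f i\<close>, hence each row level meets a genuine rectangle to
    which Q applies.\<close>
  also have "\<dots> = (\<Sum>i\<in>L1. (\<Sum>j\<in>{j\<in>K1. f i < g j}. B i j) + (\<Sum>j\<in>{j\<in>K1. g j \<le> f i}. B i j))"
  proof (rule sum.cong[OF refl])
    fix i assume "i \<in> L1"
    have "K1 = {j\<in>K1. f i < g j} \<union> {j\<in>K1. g j \<le> f i}" by auto
    then show "(\<Sum>j\<in>K1. B i j) = (\<Sum>j\<in>{j\<in>K1. f i < g j}. B i j) + (\<Sum>j\<in>{j\<in>K1. g j \<le> f i}. B i j)"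
      using fin1 by (subst sum.union_disjoint[symmetric]) auto
  qed
  also have "\<dots> = (\<Sum>i\<in>L1. \<Sum>j\<in>{j\<in>K1. f i < g j}. B i j) + (\<Sum>j\<in>K1. \<Sum>i\<in>{i\<in>L1. g j \<le> f i}. B i j)"
    unfolding sum.distrib using fin1 by (intro arg_cong2[where f = "(+)"] refl sum.swap_restrict)
  finally have main: "(\<Sum>i\<in>L. \<Sum>j\<in>K. B i j)
      \<le> (\<Sum>i\<in>L1. \<Sum>j\<in>{j\<in>K1. f i < g j}. B i j) + (\<Sum>j\<in>K1. \<Sum>i\<in>{i\<in>L1. g j \<le> f i}. B i j)" .

  define Sr where "Sr s = (\<Sum>i\<in>{i\<in>L1. f i = s}. \<Sum>j\<in>{j\<in>K1. s < g j}. (A i j)\<^sup>2)" for s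
  have "(\<Sum>i\<in>L1. \<Sum>j\<in>{j\<in>K1. f i < g j}. B i j)
      = (\<Sum>s\<in>f ` L1. \<Sum>i\<in>{i\<in>L1. f i = s}. \<Sum>j\<in>{j\<in>K1. s < g j}. B i j)"
    by (subst sum.image_gen[OF fin1(1), of _ f]) (auto intro!: sum.cong)
  also have "\<dots> \<le> (\<Sum>s\<in>f ` L1. Q * sqrt (Sr s * (real (card {i\<in>L1. f i = s}) * \<alpha>
      + real (card {j\<in>K1. s < g j}) * \<beta>)))"
    unfolding Sr_def using sub by (intro sum_mono Q) auto
  also have "\<dots> \<le> Q * (2 * (\<Sum>i\<in>L1. \<alpha> * x i) + 2 * (\<Sum>j\<in>K1. \<beta> * y j))"
    unfolding sum_distrib_left[symmetric, of Q]
  proof (intro mult_left_mono dyadic_levels_bound[where g = g] fin1 pos \<open>0 \<le> Q\<close>)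
    show "Sr s \<le> (\<Sum>i\<in>{i\<in>L1. f i = s}. \<alpha> * (x i)\<^sup>2)" for s
      unfolding Sr_def x2 r_def using fin sub by (intro sum_mono sum_mono2) auto
  qed (use x0 y0 floor_log2_bounds in \<open>auto simp: f_def g_def\<close>)
  also have "\<dots> \<le> Q * (2 * V + 2 * W)"
    using V1 W1 \<open>0 \<le> Q\<close> by (intro mult_left_mono add_mono) auto
  finally have H1: "(\<Sum>i\<in>L1. \<Sum>j\<in>{j\<in>K1. f i < g j}. B i j) \<le> Q * (2 * V + 2 * W)" .

  \<comment> \<open>The same argument with rows and columns exchanged. The two halves contribute 2
    each to the factor 4.\<close>
  define Sc where "Sc s = (\<Sum>j\<in>{j\<in>K1. g j = s}. \<Sum>i\<in>{i\<in>L1. s \<le> f i}. (A i j)\<^sup>2)" for s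
  have "(\<Sum>j\<in>K1. \<Sum>i\<in>{i\<in>L1. g j \<le> f i}. B i j)
      = (\<Sum>s\<in>g ` K1. \<Sum>j\<in>{j\<in>K1. g j = s}. \<Sum>i\<in>{i\<in>L1. s \<le> f i}. B i j)"
    by (subst sum.image_gen[OF fin1(2), of _ g]) (auto intro!: sum.cong)
  also have "\<dots> \<le> (\<Sum>s\<in>g ` K1. Q * sqrt (Sc s * (real (card {j\<in>K1. g j = s}) * \<beta>
      + real (card {i\<in>L1. s \<le> f i}) * \<alpha>)))"
  proof (rule sum_mono)
    fix s
    have "(\<Sum>i\<in>{i\<in>L1. s \<le> f i}. \<Sum>j\<in>{j\<in>K1. g j = s}. B i j)
      \<le> Q * sqrt ((\<Sum>i\<in>{i\<in>L1. s \<le> f i}. \<Sum>j\<in>{j\<in>K1. g j = s}. (A i j)\<^sup>2)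
           * (real (card {i\<in>L1. s \<le> f i}) * \<alpha> + real (card {j\<in>K1. g j = s}) * \<beta>))"
      using sub by (intro Q) auto
    then show "(\<Sum>j\<in>{j\<in>K1. g j = s}. \<Sum>i\<in>{i\<in>L1. s \<le> f i}. B i j)
      \<le> Q * sqrt (Sc s * (real (card {j\<in>K1. g j = s}) * \<beta> + real (card {i\<in>L1. s \<le> f i}) * \<alpha>))"
      unfolding Sc_def
      by (subst (1 2) sum.swap[of _ "{i\<in>L1. s \<le> f i}"]) (simp add: add.commute)
  qed
  also have "\<dots> \<le> Q * (2 * (\<Sum>j\<in>K1. \<beta> * y j) + 2 * (\<Sum>i\<in>L1. \<alpha> * x i))"
    unfolding sum_distrib_left[symmetric, of Q]
  proof (intro mult_left_mono dyadic_levels_bound[where g = f] fin1 pos \<open>0 \<le> Q\<close>)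
    show "Sc s \<le> (\<Sum>j\<in>{j\<in>K1. g j = s}. \<beta> * (y j)\<^sup>2)" for s
      unfolding Sc_def y2 c_def using fin sub by (intro sum_mono sum_mono2) auto
  qed (use x0 y0 floor_log2_bounds in \<open>auto simp: f_def g_def\<close>)
  also have "\<dots> \<le> Q * (2 * W + 2 * V)"
    using V1 W1 \<open>0 \<le> Q\<close> by (intro mult_left_mono add_mono) auto
  finally have H2: "(\<Sum>j\<in>K1. \<Sum>i\<in>{i\<in>L1. g j \<le> f i}. B i j) \<le> Q * (2 * W + 2 * V)" .
  have "(\<Sum>i\<in>L. \<Sum>j\<in>K. B i j) \<le> 4 * Q * (V + W)"
    using main H1 H2 by (simp add: algebra_simps)
  then show ?thesis
    unfolding V_def W_def ax by' r_def c_def by (simp add: sum_distrib_left)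
qed

section \<open>Exponential moments of bounded matrices\<close>

context prob_space
begin

lemma integrable_exp_bounded:
  fixes X :: "'a \<Rightarrow> real"
  assumes "X \<in> borel_measurable M" "\<And>\<omega>. \<omega> \<in> space M \<Longrightarrow> \<bar>X \<omega>\<bar> \<le> 1"
  shows "integrable M (\<lambda>\<omega>. exp (c * X \<omega>))"
proof (rule integrable_const_bound)
  show "AE \<omega> in M. norm (exp (c * X \<omega>)) \<le> exp \<bar>c\<bar>"
  proof (rule AE_I2)
    fix \<omega> assume "\<omega> \<in> space M"
    then have "\<bar>c * X \<omega>\<bar> \<le> \<bar>c\<bar>" using assms(2) by (simp add: abs_mult mult_left_le)
    then show "norm (exp (c * X \<omega>)) \<le> exp \<bar>c\<bar>" by simp
  qed
qed (use assms in measurable)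

text \<open>Hoeffding's lemma on an interval of length 2, where
  \<open>2\<^sup>2 / 8 = 1 / 2\<close>. It is applied to positive c; negative c follows by passing
  to -X.\<close>

lemma expectation_exp_bounded_centered:
  fixes X :: "'a \<Rightarrow> real"
  assumes X: "X \<in> borel_measurable M" "\<And>\<omega>. \<omega> \<in> space M \<Longrightarrow> \<bar>X \<omega>\<bar> \<le> 1" and "expectation X = 0"
  shows "expectation (\<lambda>\<omega>. exp (c * X \<omega>)) \<le> exp (c\<^sup>2 / 2)"
proof -
  have pos: "expectation (\<lambda>\<omega>. exp (c * X \<omega>)) \<le> exp (c\<^sup>2 / 2)"
    if c: "c > 0" and X: "X \<in> borel_measurable M" "\<And>\<omega>. \<omega> \<in> space M \<Longrightarrow> \<bar>X \<omega>\<bar> \<le> 1"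
      and "expectation X = 0" for c and X :: "'a \<Rightarrow> real"
  proof -
    interpret interval_bounded_random_variable M X "-1" 1
      using X by unfold_locales (auto intro!: AE_I2 simp: abs_le_iff minus_le_iff)
    have "ennreal (expectation (\<lambda>\<omega>. exp (c * X \<omega>))) = (\<integral>\<^sup>+\<omega>. exp (c * X \<omega>) \<partial>M)"
      using integrable_exp_bounded[OF X] by (intro nn_integral_eq_integral[symmetric]) auto
    also have "\<dots> \<le> ennreal (exp (c\<^sup>2 * (1 - (-1))\<^sup>2 / 8))"
      by (rule Hoeffdings_lemma_nn_integral_0) fact+
    finally show ?thesis by simp
  qed
  consider "c > 0" | "c = 0" | "c < 0" by linarith
  then show ?thesis
  proof cases
    case 3
    then show ?thesis using pos[of "-c" "\<lambda>\<omega>. - X \<omega>"] X \<open>expectation X = 0\<close> by simp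
  qed (use pos[of c X] assms in \<open>auto simp: prob_space\<close>)
qed

lemma expectation_exp_sum_bounded_centered:
  fixes X :: "'i \<Rightarrow> 'a \<Rightarrow> real" and c :: "'i \<Rightarrow> real"
  assumes "finite T" and indep: "indep_vars (\<lambda>_. borel) X T"
    and bd: "\<And>t \<omega>. t \<in> T \<Longrightarrow> \<omega> \<in> space M \<Longrightarrow> \<bar>X t \<omega>\<bar> \<le> 1"
    and "\<And>t. t \<in> T \<Longrightarrow> expectation (X t) = 0"
  shows "integrable M (\<lambda>\<omega>. exp (\<Sum>t\<in>T. c t * X t \<omega>))"
    and "expectation (\<lambda>\<omega>. exp (\<Sum>t\<in>T. c t * X t \<omega>)) \<le> exp ((\<Sum>t\<in>T. (c t)\<^sup>2) / 2)"
proof -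
  have meas: "X t \<in> borel_measurable M" if "t \<in> T" for t
    using indep that unfolding indep_vars_def by blast
  have ind: "indep_vars (\<lambda>_. borel) (\<lambda>t \<omega>. exp (c t * X t \<omega>)) T"
    by (rule indep_vars_compose2[OF indep]) auto
  have int: "integrable M (\<lambda>\<omega>. exp (c t * X t \<omega>))" if "t \<in> T" for t
    using meas bd that by (intro integrable_exp_bounded)
  have eq: "exp (\<Sum>t\<in>T. c t * X t \<omega>) = (\<Prod>t\<in>T. exp (c t * X t \<omega>))" for \<omega>
    using \<open>finite T\<close> by (rule exp_sum)
  show "integrable M (\<lambda>\<omega>. exp (\<Sum>t\<in>T. c t * X t \<omega>))"
    unfolding eq using \<open>finite T\<close> ind int by (rule indep_vars_integrable)
  have "expectation (\<lambda>\<omega>. exp (\<Sum>t\<in>T. c t * X t \<omega>)) = (\<Prod>t\<in>T. expectation (\<lambda>\<omega>. exp (c t * X t \<omega>)))"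
    unfolding eq using \<open>finite T\<close> ind int by (rule indep_vars_lebesgue_integral)
  also have "\<dots> \<le> (\<Prod>t\<in>T. exp ((c t)\<^sup>2 / 2))"
    using assms meas by (intro prod_mono conjI expectation_exp_bounded_centered integral_nonneg) auto
  also have "\<dots> = exp ((\<Sum>t\<in>T. (c t)\<^sup>2) / 2)"
    using \<open>finite T\<close> by (simp add: sum_divide_distrib exp_sum)
  finally show "expectation (\<lambda>\<omega>. exp (\<Sum>t\<in>T. c t * X t \<omega>)) \<le> exp ((\<Sum>t\<in>T. (c t)\<^sup>2) / 2)" .
qed

end

section \<open>Union bound over sign patterns\<close>

text \<open>A pattern is a sign vector on its support and 0 elsewhere. The sum factorises over
  coordinates: 0 contributes 1 and the two signs \<open>1 / (4 * card I)\<close> each, so the total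
  is \<open>(1 + 1 / (2 * card I)) ^ card I\<close>.\<close>

lemma sum_sign_weights_le:
  assumes "finite I" "I \<noteq> {}"
  shows "(\<Sum>u\<in>PiE I (\<lambda>_. {-1, 0, 1 :: real}). \<Prod>i\<in>I. if u i = 0 then 1 else exp (- ln (4 * real (card I))))
    \<le> exp (1 / 2)"
proof -
  define e where "e = exp (- ln (4 * real (card I)))"
  have pos: "real (card I) > 0" using assms by (simp add: card_gt_0_iff)
  then have e: "e = 1 / (4 * real (card I))" by (simp add: e_def exp_minus inverse_eq_divide)
  have "(\<Sum>u\<in>PiE I (\<lambda>_. {-1, 0, 1 :: real}). \<Prod>i\<in>I. if u i = 0 then 1 else e)
      = (\<Prod>i\<in>I. \<Sum>t\<in>{-1, 0, 1 :: real}. if t = 0 then 1 else e)"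
    using assms by (subst prod_sum_PiE) auto
  also have "\<dots> = (1 + 2 * e) ^ card I" by (simp add: algebra_simps)
  also have "\<dots> \<le> exp (2 * e) ^ card I"
    using e by (intro power_mono exp_ge_add_one_self) auto
  also have "\<dots> = exp (1 / 2)" using e pos by (simp flip: exp_of_nat_mult)
  finally show ?thesis unfolding e_def .
qed

text \<open>G is the cost of a pattern and S its variance proxy. The choice of l makes
  \<open>l\<^sup>2 * S = G\<close>, so the variance contributes 1/2 and the cost 1 to the constant
  3/2.\<close>

lemma chernoff_arith:
  fixes Z S G Y l :: real
  assumes "S > 0" "G \<ge> 1" "Y > 0" and l: "l = sqrt (G / S)"
    and le: "exp (- G) * exp (l * Z - l\<^sup>2 * S / 2) \<le> Y"
  shows "Z \<le> (3 / 2 + Y / exp 1) * sqrt (S * G)"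
proof -
  have "l * Z - l\<^sup>2 * S / 2 - G = ln (exp (- G) * exp (l * Z - l\<^sup>2 * S / 2))"
    by (simp flip: exp_add)
  also have "\<dots> \<le> ln Y" using le by (subst ln_le_cancel_iff) (use assms in auto)
  \<comment> \<open>The tangent of the logarithm at \<open>exp 1\<close> makes the bound linear in
    Y, so that only the mean of Y is needed later. That mean is at most \<open>exp 1\<close>, so the
    added term has mean at most 1.\<close>
  also have "\<dots> \<le> Y / exp 1"
    using ln_le_minus_one[of "Y / exp 1"] \<open>Y > 0\<close> by (simp add: ln_div)
  finally have *: "l * Z \<le> l\<^sup>2 * S / 2 + G + Y / exp 1" by simp
  have l2: "l\<^sup>2 * S = G" using assms by (simp add: l)
  have "l * Z \<le> (3 / 2 + Y / exp 1) * G"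
  proof -
    have "Y / exp 1 * 1 \<le> Y / exp 1 * G" using assms by (intro mult_left_mono) auto
    then show ?thesis using * l2 by (simp add: distrib_right)
  qed
  also have "G = l * sqrt (S * G)"
    using assms by (simp add: l flip: real_sqrt_mult)
  finally have "l * Z \<le> l * ((3 / 2 + Y / exp 1) * sqrt (S * G))" by (simp add: mult_ac)
  moreover have "l > 0" using assms by (simp add: l)
  ultimately show ?thesis by simp
qed

text \<open>Y is the sum over all sign patterns of the normalised exponential moments, weighted so that
  its mean stays bounded.\<close>
lemma (in prob_space) uniform_rectangle_bound:
  fixes X :: "nat \<Rightarrow> nat \<Rightarrow> 'a \<Rightarrow> real" and A :: "nat \<Rightarrow> nat \<Rightarrow> real"
  assumes fin: "finite I" "I \<noteq> {}" "finite J" "J \<noteq> {}"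
    and indep: "indep_vars (\<lambda>_. borel) (\<lambda>(i, j). X i j) (I \<times> J)"
    and mean: "\<And>i j. i \<in> I \<Longrightarrow> j \<in> J \<Longrightarrow> expectation (X i j) = 0"
    and bd: "\<And>i j \<omega>. i \<in> I \<Longrightarrow> j \<in> J \<Longrightarrow> \<omega> \<in> space M \<Longrightarrow> \<bar>X i j \<omega>\<bar> \<le> 1"
  obtains Y where "integrable M Y" "expectation Y \<le> exp 1" "\<And>\<omega>. 0 < Y \<omega>"
    "\<And>\<omega> L K \<eta> \<epsilon>. L \<subseteq> I \<Longrightarrow> K \<subseteq> J \<Longrightarrow> (\<And>i. \<eta> i = 1 \<or> \<eta> i = -1) \<Longrightarrow> (\<And>j. \<epsilon> j = 1 \<or> \<epsilon> j = -1) \<Longrightarrow>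
       (\<Sum>i\<in>L. \<Sum>j\<in>K. \<eta> i * \<epsilon> j * (A i j * X i j \<omega>))
       \<le> (3 / 2 + Y \<omega> / exp 1) * sqrt ((\<Sum>i\<in>L. \<Sum>j\<in>K. (A i j)\<^sup>2)
            * (real (card L) * ln (4 * real (card I)) + real (card K) * ln (4 * real (card J))))"
proof -
  define \<alpha> where "\<alpha> = ln (4 * real (card I))"
  define \<beta> where "\<beta> = ln (4 * real (card J))"
  have "real (card I) \<ge> 1" "real (card J) \<ge> 1"
    using fin by (simp_all add: Suc_le_eq card_gt_0_iff)
  \<comment> \<open>As \<open>exp 1\<close> is at most 3, both costs are at least 1, which yields
    the hypothesis \<open>G \<ge> 1\<close> of \<open>chernoff_arith\<close>.\<close>
  moreover have "1 \<le> ln (4 :: real)"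
    using exp_le by (subst ln_ge_iff) auto
  ultimately have \<alpha>: "\<alpha> \<ge> 1" and \<beta>: "\<beta> \<ge> 1"
    unfolding \<alpha>_def \<beta>_def by (auto simp: ln_mult intro!: add_increasing2)
  define U where "U = PiE I (\<lambda>_. {-1, 0, 1 :: real})"
  define V where "V = PiE J (\<lambda>_. {-1, 0, 1 :: real})"
  define wI where "wI u = (\<Prod>i\<in>I. if u i = (0::real) then 1 else exp (- \<alpha>))" for u
  define wJ where "wJ v = (\<Prod>j\<in>J. if v j = (0::real) then 1 else exp (- \<beta>))" for v
  have w0: "wI u > 0" "wJ v > 0" for u v by (auto simp: wI_def wJ_def intro!: prod_pos)
  have finUV: "finite U" "finite V" unfolding U_def V_def using fin by (auto intro!: finite_PiE)
  define S where "S u v = (\<Sum>i\<in>I. \<Sum>j\<in>J. (A i j)\<^sup>2 * ((u i)\<^sup>2 * (v j)\<^sup>2))" for u v :: "nat \<Rightarrow> real"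
  \<comment> \<open>Minus the logarithm of the weight is the cost of the pattern, so this is the
    parameter of \<open>chernoff_arith\<close>. If \<open>S u v = 0\<close>, division by zero gives
    l = 0, and the exponential term is the constant 1.\<close>
  define l where "l u v = sqrt (- ln (wI u * wJ v) / S u v)" for u v
  define Z where "Z u v \<omega> = (\<Sum>i\<in>I. \<Sum>j\<in>J. u i * v j * (A i j * X i j \<omega>))" for u v \<omega>
  define Y where "Y \<omega> = (\<Sum>u\<in>U. \<Sum>v\<in>V. wI u * wJ v * exp (l u v * Z u v \<omega> - (l u v)\<^sup>2 * S u v / 2))" for \<omega>
  have UV0: "(\<lambda>i\<in>I. 0) \<in> U" "(\<lambda>j\<in>J. 0) \<in> V" by (auto simp: U_def V_def)
  have Ypos: "Y \<omega> > 0" for \<omega>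
    unfolding Y_def using finUV UV0 w0 by (intro sum_pos) auto
  have term_int: "integrable M (\<lambda>\<omega>. exp (l u v * Z u v \<omega> - (l u v)\<^sup>2 * S u v / 2))"
    and term_le: "expectation (\<lambda>\<omega>. exp (l u v * Z u v \<omega> - (l u v)\<^sup>2 * S u v / 2)) \<le> 1" for u v
  proof -
    define c where "c t = (case t of (i, j) \<Rightarrow> l u v * (u i * v j * A i j))" for t
    have lZ: "l u v * Z u v \<omega> = (\<Sum>t\<in>I \<times> J. c t * (case t of (i, j) \<Rightarrow> X i j) \<omega>)" for \<omega>
      by (simp add: Z_def c_def sum.cartesian_product' sum_distrib_left mult_ac)
    have lS: "(l u v)\<^sup>2 * S u v = (\<Sum>t\<in>I \<times> J. (c t)\<^sup>2)"
      by (simp add: S_def c_def sum.cartesian_product' sum_distrib_left power_mult_distrib mult_ac)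
    have "integrable M (\<lambda>\<omega>. exp (\<Sum>t\<in>I \<times> J. c t * (case t of (i, j) \<Rightarrow> X i j) \<omega>))"
      and "expectation (\<lambda>\<omega>. exp (\<Sum>t\<in>I \<times> J. c t * (case t of (i, j) \<Rightarrow> X i j) \<omega>))
        \<le> exp ((\<Sum>t\<in>I \<times> J. (c t)\<^sup>2) / 2)"
      using fin mean bd by (auto intro!: expectation_exp_sum_bounded_centered indep)
    then have I: "integrable M (\<lambda>\<omega>. exp (l u v * Z u v \<omega>))"
      and E: "expectation (\<lambda>\<omega>. exp (l u v * Z u v \<omega>)) \<le> exp ((l u v)\<^sup>2 * S u v / 2)"
      by (simp_all only: lZ lS)
    show "integrable M (\<lambda>\<omega>. exp (l u v * Z u v \<omega> - (l u v)\<^sup>2 * S u v / 2))"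
      using I by (simp add: exp_diff)
    show "expectation (\<lambda>\<omega>. exp (l u v * Z u v \<omega> - (l u v)\<^sup>2 * S u v / 2)) \<le> 1"
      using E by (simp add: exp_diff)
  qed
  have Yint: "integrable M Y"
    unfolding Y_def using term_int by (intro Bochner_Integration.integrable_sum integrable_mult_right)
  have Yle: "expectation Y \<le> exp 1"
  proof -
    have "expectation Y = (\<Sum>u\<in>U. \<Sum>v\<in>V. wI u * wJ v
        * expectation (\<lambda>\<omega>. exp (l u v * Z u v \<omega> - (l u v)\<^sup>2 * S u v / 2)))"
      unfolding Y_def using term_int
      by (simp add: Bochner_Integration.integral_sum)
    also have "\<dots> \<le> (\<Sum>u\<in>U. \<Sum>v\<in>V. wI u * wJ v)"
      using w0 term_le by (intro sum_mono) (simp add: mult_left_le less_imp_le)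
    also have "\<dots> = (\<Sum>u\<in>U. wI u) * (\<Sum>v\<in>V. wJ v)" by (simp add: sum_product)
    also have "\<dots> \<le> exp (1 / 2) * exp (1 / 2)"
      unfolding U_def V_def wI_def wJ_def \<alpha>_def \<beta>_def using fin
      by (intro mult_mono sum_sign_weights_le) (auto intro!: sum_nonneg prod_nonneg split: if_splits)
    also have "\<dots> = exp 1" by (simp flip: exp_add)
    finally show ?thesis .
  qed
  have "(\<Sum>i\<in>L. \<Sum>j\<in>K. \<eta> i * \<epsilon> j * (A i j * X i j \<omega>))
       \<le> (3 / 2 + Y \<omega> / exp 1) * sqrt ((\<Sum>i\<in>L. \<Sum>j\<in>K. (A i j)\<^sup>2) * (real (card L) * \<alpha> + real (card K) * \<beta>))"
    (is "?Z \<le> _ * sqrt (?S * ?G)")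
    if LK: "L \<subseteq> I" "K \<subseteq> J" and \<eta>: "\<And>i. \<eta> i = 1 \<or> \<eta> i = -1" and \<epsilon>: "\<And>j. \<epsilon> j = 1 \<or> \<epsilon> j = -1"
    for \<omega> L K and \<eta> \<epsilon> :: "nat \<Rightarrow> real"
  proof -
    have finLK: "finite L" "finite K" using LK fin finite_subset by blast+
    have S0: "?S \<ge> 0" by (simp add: sum_nonneg)
    show ?thesis
    \<comment> \<open>If S is 0, all entries of the rectangle vanish and so do both sides. Otherwise
      L is nonempty, hence the cost is at least 1.\<close>
    proof (cases "?S = 0")
      case True
      then have "\<forall>i\<in>L. \<forall>j\<in>K. A i j = 0"
        using finLK by (simp add: sum_nonneg_eq_0_iff sum_nonneg)
      then have "?Z = 0" by (intro sum.neutral ballI) auto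
      then show ?thesis using True by simp
    next
      case False
      then have Spos: "?S > 0" using S0 by simp
      have "L \<noteq> {}" using False by auto
      then have "1 * 1 \<le> real (card L) * \<alpha>"
        using finLK \<alpha> by (intro mult_mono) (auto simp: Suc_le_eq card_gt_0_iff)
      then have G1: "?G \<ge> 1" using \<beta> by (simp add: add_increasing2)
      define u where "u = (\<lambda>i\<in>I. if i \<in> L then \<eta> i else 0)"
      define v where "v = (\<lambda>j\<in>J. if j \<in> K then \<epsilon> j else 0)"
      have "u i \<in> {-1, 0, 1}" if "i \<in> I" for i using \<eta>[of i] that by (auto simp: u_def)
      then have uU: "u \<in> U" by (simp add: U_def u_def PiE_iff)
      have "v j \<in> {-1, 0, 1}" if "j \<in> J" for j using \<epsilon>[of j] that by (auto simp: v_def)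
      then have vV: "v \<in> V" by (simp add: V_def v_def PiE_iff)
      have [simp]: "\<eta> i \<noteq> 0" "\<epsilon> i \<noteq> 0" "(\<eta> i)\<^sup>2 = 1" "(\<epsilon> i)\<^sup>2 = 1" for i
        using \<eta>[of i] \<epsilon>[of i] by auto
      have wu: "wI u = exp (- \<alpha>) ^ card L"
      proof -
        have "wI u = (\<Prod>i\<in>L. exp (- \<alpha>))"
          unfolding wI_def using fin LK by (intro prod.mono_neutral_cong_right) (auto simp: u_def)
        then show ?thesis by simp
      qed
      have wv: "wJ v = exp (- \<beta>) ^ card K"
      proof -
        have "wJ v = (\<Prod>j\<in>K. exp (- \<beta>))"
          unfolding wJ_def using fin LK by (intro prod.mono_neutral_cong_right) (auto simp: v_def)
        then show ?thesis by simp
      qed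
      have w: "wI u * wJ v = exp (- ?G)"
        by (simp add: wu wv flip: exp_of_nat_mult exp_add)
      have restrict: "(\<Sum>i\<in>I. \<Sum>j\<in>J. h i j) = (\<Sum>i\<in>L. \<Sum>j\<in>K. h i j)"
        if "\<And>i j. i \<in> I \<Longrightarrow> j \<in> J \<Longrightarrow> i \<notin> L \<or> j \<notin> K \<Longrightarrow> h i j = 0" for h :: "nat \<Rightarrow> nat \<Rightarrow> real"
      proof -
        have "(\<Sum>i\<in>I. \<Sum>j\<in>J. h i j) = (\<Sum>i\<in>L. \<Sum>j\<in>J. h i j)"
          using fin LK that by (intro sum.mono_neutral_right) (auto intro!: sum.neutral)
        also have "\<dots> = (\<Sum>i\<in>L. \<Sum>j\<in>K. h i j)"
          using fin LK that by (intro sum.cong refl sum.mono_neutral_right) auto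
        finally show ?thesis .
      qed
      have Suv: "S u v = ?S"
        unfolding S_def using LK
        by (subst restrict) (auto simp: u_def v_def intro!: sum.cong)
      have Zuv: "Z u v \<omega> = ?Z"
        unfolding Z_def using LK
        by (subst restrict) (auto simp: u_def v_def intro!: sum.cong)
      \<comment> \<open>All summands of Y are positive, so Y dominates the one belonging to this
        pattern; its weight is \<open>exp (- ?G)\<close>.\<close>
      have "wI u * wJ v * exp (l u v * Z u v \<omega> - (l u v)\<^sup>2 * S u v / 2)
        \<le> (\<Sum>v\<in>V. wI u * wJ v * exp (l u v * Z u v \<omega> - (l u v)\<^sup>2 * S u v / 2))"
        using vV finUV w0 by (intro member_le_sum) (auto intro: less_imp_le)
      also have "\<dots> \<le> Y \<omega>"
        unfolding Y_def using uU finUV w0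
        by (intro member_le_sum[of u U]) (auto intro!: sum_nonneg intro: less_imp_le)
      finally have "exp (- ?G) * exp (l u v * ?Z - (l u v)\<^sup>2 * ?S / 2) \<le> Y \<omega>"
        unfolding w Suv Zuv .
      moreover have "l u v = sqrt (?G / ?S)" by (simp add: l_def w Suv)
      ultimately show ?thesis
        using Spos G1 Ypos by (intro chernoff_arith) auto
    qed
  qed
  then show ?thesis
    by (intro that[of Y, OF Yint Yle Ypos]) (simp_all add: \<alpha>_def \<beta>_def)
qed

section \<open>The expected norm\<close>

lemma opnorm_nonneg:
  assumes "finite I" "finite J" "0 < s" "0 < t"
  shows "0 \<le> opnorm B s t J I"
proof -
  have "(\<lambda>_. 0) \<in> lball s J"
    using assms by (auto simp: lball_def lnorm_def)
  then have "lnorm t I (\<lambda>i. \<Sum>j\<in>J. B i j * 0) \<le> opnorm B s t J I"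
    unfolding opnorm_def using bdd_above_opnorm[OF assms]
    by (rule cSUP_upper[where f = "\<lambda>x. lnorm t I (\<lambda>i. \<Sum>j\<in>J. B i j * x j)" and x = "\<lambda>_. 0"])
  then show ?thesis using lnorm_nonneg[OF assms(1)] order_trans by blast
qed

lemma opnorm_half_nonneg:
  assumes "finite I" "finite J" "1 \<le> p" "1 \<le> q"
  shows "0 \<le> opnorm B (p / 2) (q / 2) J I"
proof (rule opnorm_nonneg[OF assms(1,2)])
  show "0 < p / 2" using assms by (cases p) (simp_all add: one_ereal_def)
  show "0 < q / 2" using assms by (cases q) (simp_all add: one_ereal_def)
qed

text \<open>The weights by which \<open>opnorm_flat\<close> normalises a sign pattern are exactly
  those produced by testing the squared matrix on flat vectors, so the two match for every L and
  K.\<close>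

lemma opnorm_le_of_Chevet:
  fixes A B :: "nat \<Rightarrow> nat \<Rightarrow> real"
  assumes fin: "finite I" "I \<noteq> {}" "finite J" "J \<noteq> {}" and pq: "1 \<le> p" "1 \<le> q"
    and c: "0 \<le> c1" "0 \<le> c2"
    and B: "\<And>L K \<eta> \<epsilon>. L \<subseteq> I \<Longrightarrow> L \<noteq> {} \<Longrightarrow> K \<subseteq> J \<Longrightarrow> K \<noteq> {} \<Longrightarrow>
       (\<And>i. \<eta> i = 1 \<or> \<eta> i = -1) \<Longrightarrow> (\<And>j. \<epsilon> j = 1 \<or> \<epsilon> j = -1) \<Longrightarrow>
       (\<Sum>i\<in>L. \<Sum>j\<in>K. \<eta> i * \<epsilon> j * B i j)
         \<le> c1 * (\<Sum>i\<in>L. sqrt (\<Sum>j\<in>K. (A i j)\<^sup>2)) + c2 * (\<Sum>j\<in>K. sqrt (\<Sum>i\<in>L. (A i j)\<^sup>2))"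
  shows "opnorm B p q J I
    \<le> ln (exp 1 * real (card J)) powr einv (hconj p) * ln (exp 1 * real (card I)) powr einv q *
       (c1 * sqrt (opnorm (\<lambda>i j. (A i j)\<^sup>2) (p / 2) (q / 2) J I)
        + c2 * sqrt (opnorm (\<lambda>j i. (A i j)\<^sup>2) (hconj q / 2) (hconj p / 2) I J))"
    (is "_ \<le> _ * (c1 * sqrt ?R + c2 * sqrt ?C)")
proof (rule opnorm_flat[OF fin pq])
  have "0 \<le> ?R" "0 \<le> ?C"
    using fin pq by (simp_all only: opnorm_half_nonneg one_le_hconj)
  then show "0 \<le> c1 * sqrt ?R + c2 * sqrt ?C" using c by simp
next
  fix L K and \<eta> \<epsilon> :: "nat \<Rightarrow> real"
  assume LK: "L \<subseteq> I" "L \<noteq> {}" "K \<subseteq> J" "K \<noteq> {}"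
    and signs: "\<And>i. \<eta> i = 1 \<or> \<eta> i = -1" "\<And>j. \<epsilon> j = 1 \<or> \<epsilon> j = -1"
  let ?w = "real (card L) powr einv (hconj q) * real (card K) powr einv p"
  have R: "(\<Sum>i\<in>L. sqrt (\<Sum>j\<in>K. (A i j)\<^sup>2)) \<le> sqrt ?R * ?w"
    using sum_sqrt_rows_le_opnorm[OF fin(1,3) pq LK, of A] by (simp add: mult_ac)
  \<comment> \<open>The column estimate is the row estimate for the transpose with exponents
    \<open>hconj q\<close> and \<open>hconj p\<close>; double conjugation restores the same
    weight.\<close>
  have C: "(\<Sum>j\<in>K. sqrt (\<Sum>i\<in>L. (A i j)\<^sup>2)) \<le> sqrt ?C * ?w"
    using sum_sqrt_rows_le_opnorm[OF fin(3,1) one_le_hconj[OF pq(2)] one_le_hconj[OF pq(1)] LK(3,4,1,2),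
        of "\<lambda>j i. A i j"] pq
    by (simp add: hconj_hconj mult_ac)
  have "(\<Sum>i\<in>L. \<Sum>j\<in>K. \<eta> i * \<epsilon> j * B i j) \<le> c1 * (sqrt ?R * ?w) + c2 * (sqrt ?C * ?w)"
  proof (rule order_trans[OF B])
    show "c1 * (\<Sum>i\<in>L. sqrt (\<Sum>j\<in>K. (A i j)\<^sup>2)) + c2 * (\<Sum>j\<in>K. sqrt (\<Sum>i\<in>L. (A i j)\<^sup>2))
        \<le> c1 * (sqrt ?R * ?w) + c2 * (sqrt ?C * ?w)"
      by (intro add_mono mult_left_mono R C c)
  qed (fact LK signs)+
  then show "(\<Sum>i\<in>L. \<Sum>j\<in>K. \<eta> i * \<epsilon> j * B i j)
      \<le> (c1 * sqrt ?R + c2 * sqrt ?C) * real (card L) powr einv (hconj q) * real (card K) powr einv p"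
    by (simp add: algebra_simps)
qed

text \<open>For M at least 2, \<open>ln (4 * M)\<close> is at most \<open>3 * ln M\<close>, and
  squaring leaves 300 against \<open>128 * pi\<close>. At M = 1 the right-hand side is 0.\<close>

lemma ten_sqrt_ln_le:
  assumes "2 \<le> M"
  shows "10 * sqrt (ln (4 * real M)) \<le> 8 * sqrt (2 * pi) * sqrt (ln (real M))"
proof -
  have "ln 2 \<le> ln (real M)" using assms by (subst ln_le_cancel_iff) auto
  moreover have "ln (4 :: real) = 2 * ln 2" using ln_realpow[of 2 2] by simp
  ultimately have "ln (4 * real M) \<le> 3 * ln (real M)"
    using assms by (simp add: ln_mult)
  then have "100 * ln (4 * real M) \<le> 300 * ln (real M)" by simp
  also have "\<dots> \<le> (64 * (2 * pi)) * ln (real M)"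
    using pi_gt3 assms by (intro mult_right_mono) auto
  finally have "sqrt (100 * ln (4 * real M)) \<le> sqrt ((64 * (2 * pi)) * ln (real M))"
    by (rule real_sqrt_le_mono)
  moreover have "sqrt 100 = (10 :: real)" "sqrt 64 = (8 :: real)"
    by (auto intro: real_sqrt_unique)
  ultimately show ?thesis by (simp only: real_sqrt_mult)
qed

lemma (in prob_space) bounded_matrix_Chevet:
  fixes X :: "nat \<Rightarrow> nat \<Rightarrow> 'a \<Rightarrow> real" and A :: "nat \<Rightarrow> nat \<Rightarrow> real" and M' N :: nat
  assumes mn: "1 \<le> M'" "1 \<le> N"
    and indep: "indep_vars (\<lambda>_. borel) (\<lambda>(i, j). X i j) ({1..M'} \<times> {1..N})"
    and mean: "\<And>i j. i \<in> {1..M'} \<Longrightarrow> j \<in> {1..N} \<Longrightarrow> expectation (X i j) = 0"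
    and bd: "\<And>i j \<omega>. i \<in> {1..M'} \<Longrightarrow> j \<in> {1..N} \<Longrightarrow> \<omega> \<in> space M \<Longrightarrow> \<bar>X i j \<omega>\<bar> \<le> 1"
  obtains Q :: "'a \<Rightarrow> real" where "integrable M Q" "expectation Q \<le> 1" "\<And>\<omega>. 0 \<le> Q \<omega>"
    "\<And>\<omega> L K \<eta> \<epsilon>. \<omega> \<in> space M \<Longrightarrow> L \<subseteq> {1..M'} \<Longrightarrow> L \<noteq> {} \<Longrightarrow> K \<subseteq> {1..N} \<Longrightarrow> K \<noteq> {} \<Longrightarrow>
       (\<And>i. \<eta> i = 1 \<or> \<eta> i = -1) \<Longrightarrow> (\<And>j. \<epsilon> j = 1 \<or> \<epsilon> j = -1) \<Longrightarrow>
       (\<Sum>i\<in>L. \<Sum>j\<in>K. \<eta> i * \<epsilon> j * (A i j * X i j \<omega>))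
       \<le> Q \<omega> * ((8 * sqrt (2 * pi) * sqrt (ln (real M')) + 2) * (\<Sum>i\<in>L. sqrt (\<Sum>j\<in>K. (A i j)\<^sup>2))
            + (8 * sqrt (2 * pi) * sqrt (ln (real N)) + 4) * (\<Sum>j\<in>K. sqrt (\<Sum>i\<in>L. (A i j)\<^sup>2)))"
proof -
  define cR where "cR = 8 * sqrt (2 * pi) * sqrt (ln (real M')) + 2"
  define cC where "cC = 8 * sqrt (2 * pi) * sqrt (ln (real N)) + 4"
  have cR: "2 \<le> cR" and cC: "4 \<le> cC" using mn by (auto simp: cR_def cC_def)
  have nonneg: "(\<Sum>i\<in>L. sqrt (\<Sum>j\<in>K. (A i j)\<^sup>2)) \<ge> 0" "(\<Sum>j\<in>K. sqrt (\<Sum>i\<in>L. (A i j)\<^sup>2)) \<ge> 0" for L K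
    by (auto intro!: sum_nonneg)
  show thesis
  proof (cases "M' = 1 \<or> N = 1")
    \<comment> \<open>Here the constant factor 1 suffices. With a single row the column norms are
      the absolute entries, with a single column the row norms are, so one of the two sums already
      bounds the sum of absolute values. The additive 2 and 4 keep both coefficients above
      1.\<close>
    case True
    have "(\<Sum>i\<in>L. \<Sum>j\<in>K. \<eta> i * \<epsilon> j * (A i j * X i j \<omega>))
       \<le> 1 * (cR * (\<Sum>i\<in>L. sqrt (\<Sum>j\<in>K. (A i j)\<^sup>2)) + cC * (\<Sum>j\<in>K. sqrt (\<Sum>i\<in>L. (A i j)\<^sup>2)))"
      if \<omega>: "\<omega> \<in> space M" and LK: "L \<subseteq> {1..M'}" "L \<noteq> {}" "K \<subseteq> {1..N}" "K \<noteq> {}"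
        and \<eta>: "\<And>i. \<eta> i = 1 \<or> \<eta> i = -1" and \<epsilon>: "\<And>j. \<epsilon> j = 1 \<or> \<epsilon> j = -1"
      for \<omega> L K and \<eta> \<epsilon> :: "nat \<Rightarrow> real"
    proof -
      have "(\<Sum>i\<in>L. \<Sum>j\<in>K. \<eta> i * \<epsilon> j * (A i j * X i j \<omega>)) \<le> (\<Sum>i\<in>L. \<Sum>j\<in>K. \<bar>A i j\<bar>)"
      proof (intro sum_mono)
        fix i j assume "i \<in> L" "j \<in> K"
        then have "\<bar>X i j \<omega>\<bar> \<le> 1" using bd \<omega> LK by blast
        moreover have "\<bar>\<eta> i\<bar> = 1" "\<bar>\<epsilon> j\<bar> = 1" using \<eta>[of i] \<epsilon>[of j] by auto
        ultimately have "\<bar>\<eta> i * \<epsilon> j * (A i j * X i j \<omega>)\<bar> \<le> \<bar>A i j\<bar>"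
          by (simp add: abs_mult mult_left_le)
        then show "\<eta> i * \<epsilon> j * (A i j * X i j \<omega>) \<le> \<bar>A i j\<bar>" by linarith
      qed
      also have "\<dots> \<le> (\<Sum>i\<in>L. sqrt (\<Sum>j\<in>K. (A i j)\<^sup>2)) + (\<Sum>j\<in>K. sqrt (\<Sum>i\<in>L. (A i j)\<^sup>2))"
        using True
      proof
        assume "M' = 1"
        then have "L = {1}" using LK by auto
        then show ?thesis using nonneg[of _ K] by (simp add: sum_nonneg)
      next
        assume "N = 1"
        then have "K = {1}" using LK by auto
        then show ?thesis by (simp add: sum_nonneg)
      qed
      also have "\<dots> \<le> cR * (\<Sum>i\<in>L. sqrt (\<Sum>j\<in>K. (A i j)\<^sup>2)) + cC * (\<Sum>j\<in>K. sqrt (\<Sum>i\<in>L. (A i j)\<^sup>2))"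
        using cR cC mult_right_mono[of 1 cR "\<Sum>i\<in>L. sqrt (\<Sum>j\<in>K. (A i j)\<^sup>2)"]
          mult_right_mono[of 1 cC "\<Sum>j\<in>K. sqrt (\<Sum>i\<in>L. (A i j)\<^sup>2)"]
        by (intro add_mono) (simp_all add: nonneg)
      finally show ?thesis by simp
    qed
    then show thesis
      by (intro that[of "\<lambda>_. 1"]) (auto simp: prob_space cR_def cC_def)
  next
    case False
    then have MN2: "2 \<le> M'" "2 \<le> N" using mn by auto
    define \<alpha> where "\<alpha> = ln (4 * real M')"
    define \<beta> where "\<beta> = ln (4 * real N)"
    have \<alpha>: "\<alpha> > 0" and \<beta>: "\<beta> > 0" using mn by (auto simp: \<alpha>_def \<beta>_def)
    have \<alpha>c: "10 * sqrt \<alpha> \<le> cR" and \<beta>c: "10 * sqrt \<beta> \<le> cC"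
      using ten_sqrt_ln_le[OF MN2(1)] ten_sqrt_ln_le[OF MN2(2)]
      unfolding \<alpha>_def \<beta>_def cR_def cC_def by linarith+
    obtain Y where Y: "integrable M Y" "expectation Y \<le> exp 1" "\<And>\<omega>. 0 < Y \<omega>"
      and rect: "\<And>\<omega> L K \<eta> \<epsilon>. L \<subseteq> {1..M'} \<Longrightarrow> K \<subseteq> {1..N} \<Longrightarrow> (\<And>i. \<eta> i = 1 \<or> \<eta> i = -1) \<Longrightarrow>
        (\<And>j. \<epsilon> j = 1 \<or> \<epsilon> j = -1) \<Longrightarrow>
        (\<Sum>i\<in>L. \<Sum>j\<in>K. \<eta> i * \<epsilon> j * (A i j * X i j \<omega>))
        \<le> (3 / 2 + Y \<omega> / exp 1) * sqrt ((\<Sum>i\<in>L. \<Sum>j\<in>K. (A i j)\<^sup>2) * (real (card L) * \<alpha> + real (card K) * \<beta>))"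
      by (rule uniform_rectangle_bound[of "{1..M'}" "{1..N}" X A])
        (use mn indep mean bd in \<open>auto simp: \<alpha>_def \<beta>_def\<close>)
    \<comment> \<open>The mean of \<open>3 / 2 + Y / exp 1\<close> is at most 5/2. Dividing by it
      gives mean at most 1 and leaves \<open>4 * (5 / 2) = 10\<close> for the deterministic
      coefficients.\<close>
    define Q where "Q \<omega> = (3 / 2 + Y \<omega> / exp 1) / (5 / 2)" for \<omega>
    have Q0: "Q \<omega> \<ge> 0" for \<omega> using Y(3)[of \<omega>] by (simp add: Q_def less_imp_le)
    have Qint: "integrable M Q" unfolding Q_def using Y(1) by simp
    have Qle: "expectation Q \<le> 1"
    proof -
      have "expectation Q = (3 / 2 + expectation Y / exp 1) / (5 / 2)"
        unfolding Q_def using Y(1) by (simp add: prob_space)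
      also have "\<dots> \<le> 1" using Y(2) by (simp add: field_simps)
      finally show ?thesis .
    qed
    have bound: "(\<Sum>i\<in>L. \<Sum>j\<in>K. \<eta> i * \<epsilon> j * (A i j * X i j \<omega>))
       \<le> Q \<omega> * (cR * (\<Sum>i\<in>L. sqrt (\<Sum>j\<in>K. (A i j)\<^sup>2)) + cC * (\<Sum>j\<in>K. sqrt (\<Sum>i\<in>L. (A i j)\<^sup>2)))"
      if LK: "L \<subseteq> {1..M'}" "K \<subseteq> {1..N}"
        and \<eta>: "\<And>i. \<eta> i = 1 \<or> \<eta> i = -1" and \<epsilon>: "\<And>j. \<epsilon> j = 1 \<or> \<epsilon> j = -1"
      for \<omega> L K and \<eta> \<epsilon> :: "nat \<Rightarrow> real"
    proof -
      let ?r = "\<Sum>i\<in>L. sqrt (\<Sum>j\<in>K. (A i j)\<^sup>2)" and ?c = "\<Sum>j\<in>K. sqrt (\<Sum>i\<in>L. (A i j)\<^sup>2)"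
      have "(\<Sum>i\<in>L. \<Sum>j\<in>K. \<eta> i * \<epsilon> j * (A i j * X i j \<omega>))
          \<le> 4 * (3 / 2 + Y \<omega> / exp 1) * (sqrt \<alpha> * ?r + sqrt \<beta> * ?c)"
      proof (rule subrectangle_bounds_imp_Chevet)
        show "finite L" "finite K" using LK finite_subset by blast+
        show "0 \<le> 3 / 2 + Y \<omega> / exp 1" using Y(3)[of \<omega>] by (simp add: less_imp_le)
        show "(\<Sum>i\<in>L'. \<Sum>j\<in>K'. \<eta> i * \<epsilon> j * (A i j * X i j \<omega>))
            \<le> (3 / 2 + Y \<omega> / exp 1) * sqrt ((\<Sum>i\<in>L'. \<Sum>j\<in>K'. (A i j)\<^sup>2)
              * (real (card L') * \<alpha> + real (card K') * \<beta>))"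
          if "L' \<subseteq> L" "K' \<subseteq> K" for L' K'
          using that LK by (intro rect \<eta> \<epsilon>) auto
      qed (use \<alpha> \<beta> in auto)
      also have "\<dots> = Q \<omega> * ((10 * sqrt \<alpha>) * ?r + (10 * sqrt \<beta>) * ?c)"
      proof -
        have "3 / 2 + Y \<omega> / exp 1 = 5 / 2 * Q \<omega>" by (simp add: Q_def)
        then show ?thesis by (simp only:) (simp add: algebra_simps)
      qed
      also have "\<dots> \<le> Q \<omega> * (cR * ?r + cC * ?c)"
        by (intro mult_left_mono add_mono mult_right_mono \<alpha>c \<beta>c nonneg Q0)
      finally show ?thesis .
    qed
    show thesis
      by (rule that[OF Qint Qle Q0]) (rule bound[unfolded cR_def cC_def]; assumption)
  qed
qed

lemma opnorm_eq_SUP_bilinear: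
  assumes "finite I" "1 \<le> q"
  shows "opnorm B p q J I = (SUP x\<in>lball p J. SUP y\<in>lball (hconj q) I. \<Sum>i\<in>I. \<Sum>j\<in>J. y i * B i j * x j)"
  unfolding opnorm_def lnorm_eq_SUP[OF assms] by (simp add: sum_distrib_left mult_ac)

theorem theorem3p3:
  fixes P :: "'a measure" and X :: "nat \<Rightarrow> nat \<Rightarrow> 'a \<Rightarrow> real"
    and A :: "nat \<Rightarrow> nat \<Rightarrow> real" and m n M N :: nat and p q :: ereal
  assumes "prob_space P"
    and "1 \<le> m" "m \<le> M" "1 \<le> n" "n \<le> N"
    and "1 \<le> p" "1 \<le> q"
    and "\<And>i j. i \<in> {1..M} \<Longrightarrow> j \<in> {1..N} \<Longrightarrow> X i j \<in> borel_measurable P"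
    and "prob_space.indep_vars P (\<lambda>_. borel) (\<lambda>(i, j). X i j) ({1..M} \<times> {1..N})"
    and "\<And>i j. i \<in> {1..M} \<Longrightarrow> j \<in> {1..N} \<Longrightarrow> prob_space.expectation P (X i j) = 0"
    and "\<And>i j \<omega>. i \<in> {1..M} \<Longrightarrow> j \<in> {1..N} \<Longrightarrow> \<omega> \<in> space P \<Longrightarrow> \<bar>X i j \<omega>\<bar> \<le> 1"
  defines "\<II> \<equiv> {I. I \<subseteq> {1..M} \<and> card I = m}"
    and "\<JJ> \<equiv> {J. J \<subseteq> {1..N} \<and> card J = n}"
  shows
    "prob_space.expectation P
        (\<lambda>\<omega>. SUP (I, J)\<in>\<II> \<times> \<JJ>. opnorm (\<lambda>i j. A i j * X i j \<omega>) p q J I)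
     = prob_space.expectation P
        (\<lambda>\<omega>. SUP (I, J)\<in>\<II> \<times> \<JJ>. SUP x\<in>lball p J. SUP y\<in>lball (hconj q) I.
              (\<Sum>i\<in>I. \<Sum>j\<in>J. y i * A i j * X i j \<omega> * x j))
   \<and> prob_space.expectation P
        (\<lambda>\<omega>. SUP (I, J)\<in>\<II> \<times> \<JJ>. opnorm (\<lambda>i j. A i j * X i j \<omega>) p q J I)
     \<le> ln (exp 1 * real n) powr einv (hconj p) * ln (exp 1 * real m) powr einv q *
        ((2.4 * sqrt (2 * pi) * sqrt (ln (real m * real n)) + 8 * sqrt (2 * pi) * sqrt (ln (real M)) + 2)
           * (SUP (I, J)\<in>\<II> \<times> \<JJ>. opnorm (\<lambda>i j. (A i j)\<^sup>2) (p / 2) (q / 2) J I) powr (1 / 2)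
         + (8 * sqrt (2 * pi) * sqrt (ln (real N)) + 4)
           * (SUP (I, J)\<in>\<II> \<times> \<JJ>. opnorm (\<lambda>j i. (A i j)\<^sup>2) (hconj q / 2) (hconj p / 2) I J) powr (1 / 2))"
proof -
  interpret prob_space P by fact
  have finIJ: "finite (\<II> \<times> \<JJ>)" unfolding \<II>_def \<JJ>_def by (intro finite_cartesian_product) auto
  have "{1..m} \<in> \<II>" "{1..n} \<in> \<JJ>" using assms by (auto simp: \<II>_def \<JJ>_def)
  then have neIJ: "\<II> \<times> \<JJ> \<noteq> {}" by blast
  have IJ: "finite I" "I \<noteq> {}" "I \<subseteq> {1..M}" "card I = m" "finite J" "J \<noteq> {}" "J \<subseteq> {1..N}" "card J = n"
    if "(I, J) \<in> \<II> \<times> \<JJ>" for I J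
    using that \<open>1 \<le> m\<close> \<open>1 \<le> n\<close> by (auto simp: \<II>_def \<JJ>_def intro: finite_subset)

  \<comment> \<open>The identity holds at each sample point, so the expectations agree without any
    integrability argument.\<close>
  have eq: "(SUP (I, J)\<in>\<II> \<times> \<JJ>. opnorm (\<lambda>i j. A i j * X i j \<omega>) p q J I)
      = (SUP (I, J)\<in>\<II> \<times> \<JJ>. SUP x\<in>lball p J. SUP y\<in>lball (hconj q) I.
              (\<Sum>i\<in>I. \<Sum>j\<in>J. y i * A i j * X i j \<omega> * x j))" for \<omega>
    using IJ \<open>1 \<le> q\<close> by (intro SUP_cong refl) (auto simp: opnorm_eq_SUP_bilinear mult_ac)

  define R where "R = (SUP (I, J)\<in>\<II> \<times> \<JJ>. opnorm (\<lambda>i j. (A i j)\<^sup>2) (p / 2) (q / 2) J I)"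
  define C where "C = (SUP (I, J)\<in>\<II> \<times> \<JJ>. opnorm (\<lambda>j i. (A i j)\<^sup>2) (hconj q / 2) (hconj p / 2) I J)"
  have R: "opnorm (\<lambda>i j. (A i j)\<^sup>2) (p / 2) (q / 2) J I \<le> R"
    and C: "opnorm (\<lambda>j i. (A i j)\<^sup>2) (hconj q / 2) (hconj p / 2) I J \<le> C"
    if "(I, J) \<in> \<II> \<times> \<JJ>" for I J
    unfolding R_def C_def
    using cSUP_upper[OF that, of "\<lambda>(I, J). opnorm (\<lambda>i j. (A i j)\<^sup>2) (p / 2) (q / 2) J I"]
      cSUP_upper[OF that, of "\<lambda>(I, J). opnorm (\<lambda>j i. (A i j)\<^sup>2) (hconj q / 2) (hconj p / 2) I J"] finIJ
    by auto
  obtain I0 J0 where IJ0: "(I0, J0) \<in> \<II> \<times> \<JJ>" using neIJ by auto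
  have "0 \<le> opnorm (\<lambda>i j. (A i j)\<^sup>2) (p / 2) (q / 2) J0 I0"
    "0 \<le> opnorm (\<lambda>j i. (A i j)\<^sup>2) (hconj q / 2) (hconj p / 2) I0 J0"
    using IJ[OF IJ0] \<open>1 \<le> p\<close> \<open>1 \<le> q\<close>
    by (simp_all only: opnorm_half_nonneg one_le_hconj)
  then have RC0: "0 \<le> R" "0 \<le> C" using R[OF IJ0] C[OF IJ0] by linarith+

  define c0 where "c0 = 2.4 * sqrt (2 * pi) * sqrt (ln (real m * real n))"
  define cR where "cR = 8 * sqrt (2 * pi) * sqrt (ln (real M)) + 2"
  define cC where "cC = 8 * sqrt (2 * pi) * sqrt (ln (real N)) + 4"
  have MN: "1 \<le> M" "1 \<le> N" using assms by auto
  have "1 * 1 \<le> real m * real n" using assms by (intro mult_mono) auto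
  then have c0: "0 \<le> c0" by (simp add: c0_def)
  have cRC: "0 \<le> cR" "0 \<le> cC" using MN by (auto simp: cR_def cC_def)
  define H where "H = ln (exp 1 * real n) powr einv (hconj p) * ln (exp 1 * real m) powr einv q"
  have H: "0 \<le> H" by (simp add: H_def)

  \<comment> \<open>Q is built for the whole matrix, before I and J are chosen, and so serves all
    submatrices at once.\<close>
  obtain Q where Q: "integrable P Q" "expectation Q \<le> 1" "\<And>\<omega>. 0 \<le> Q \<omega>"
    and chevet: "\<And>\<omega> L K \<eta> \<epsilon>. \<omega> \<in> space P \<Longrightarrow> L \<subseteq> {1..M} \<Longrightarrow> L \<noteq> {} \<Longrightarrow> K \<subseteq> {1..N} \<Longrightarrow> K \<noteq> {} \<Longrightarrow>
       (\<And>i. \<eta> i = 1 \<or> \<eta> i = -1) \<Longrightarrow> (\<And>j. \<epsilon> j = 1 \<or> \<epsilon> j = -1) \<Longrightarrow>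
       (\<Sum>i\<in>L. \<Sum>j\<in>K. \<eta> i * \<epsilon> j * (A i j * X i j \<omega>))
       \<le> Q \<omega> * (cR * (\<Sum>i\<in>L. sqrt (\<Sum>j\<in>K. (A i j)\<^sup>2)) + cC * (\<Sum>j\<in>K. sqrt (\<Sum>i\<in>L. (A i j)\<^sup>2)))"
    unfolding cR_def cC_def
    by (rule bounded_matrix_Chevet[of M N X A]) (use assms MN in auto)

  have "(SUP (I, J)\<in>\<II> \<times> \<JJ>. opnorm (\<lambda>i j. A i j * X i j \<omega>) p q J I)
      \<le> Q \<omega> * (H * (cR * sqrt R + cC * sqrt C))" if \<omega>: "\<omega> \<in> space P" for \<omega>
  proof (rule cSUP_least[OF neIJ])
    fix z assume "z \<in> \<II> \<times> \<JJ>"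
    then obtain I J where z: "z = (I, J)" and mem: "(I, J) \<in> \<II> \<times> \<JJ>" by (cases z) auto
    note IJ' = IJ[OF mem]
    have "opnorm (\<lambda>i j. A i j * X i j \<omega>) p q J I
      \<le> ln (exp 1 * real (card J)) powr einv (hconj p) * ln (exp 1 * real (card I)) powr einv q *
       (Q \<omega> * cR * sqrt (opnorm (\<lambda>i j. (A i j)\<^sup>2) (p / 2) (q / 2) J I)
        + Q \<omega> * cC * sqrt (opnorm (\<lambda>j i. (A i j)\<^sup>2) (hconj q / 2) (hconj p / 2) I J))"
    proof (rule opnorm_le_of_Chevet)
      fix L K and \<eta> \<epsilon> :: "nat \<Rightarrow> real"
      assume "L \<subseteq> I" "L \<noteq> {}" "K \<subseteq> J" "K \<noteq> {}" "\<And>i. \<eta> i = 1 \<or> \<eta> i = -1" "\<And>j. \<epsilon> j = 1 \<or> \<epsilon> j = -1"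
      with IJ' have "(\<Sum>i\<in>L. \<Sum>j\<in>K. \<eta> i * \<epsilon> j * (A i j * X i j \<omega>))
       \<le> Q \<omega> * (cR * (\<Sum>i\<in>L. sqrt (\<Sum>j\<in>K. (A i j)\<^sup>2)) + cC * (\<Sum>j\<in>K. sqrt (\<Sum>i\<in>L. (A i j)\<^sup>2)))"
        by (intro chevet[OF \<omega>]) auto
      then show "(\<Sum>i\<in>L. \<Sum>j\<in>K. \<eta> i * \<epsilon> j * (A i j * X i j \<omega>))
       \<le> Q \<omega> * cR * (\<Sum>i\<in>L. sqrt (\<Sum>j\<in>K. (A i j)\<^sup>2)) + Q \<omega> * cC * (\<Sum>j\<in>K. sqrt (\<Sum>i\<in>L. (A i j)\<^sup>2))"
        by (simp only: distrib_left mult.assoc)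
    qed (use IJ' assms cRC Q(3) in auto)
    also have "\<dots> = H * (Q \<omega> * cR * sqrt (opnorm (\<lambda>i j. (A i j)\<^sup>2) (p / 2) (q / 2) J I)
        + Q \<omega> * cC * sqrt (opnorm (\<lambda>j i. (A i j)\<^sup>2) (hconj q / 2) (hconj p / 2) I J))"
      using IJ' by (simp add: H_def)
    also have "\<dots> \<le> H * (Q \<omega> * cR * sqrt R + Q \<omega> * cC * sqrt C)"
      using R[OF mem] C[OF mem] H cRC Q(3)
      by (intro mult_left_mono add_mono real_sqrt_le_mono) auto
    also have "\<dots> = Q \<omega> * (H * (cR * sqrt R + cC * sqrt C))" by (simp only: distrib_left mult_ac)
    finally show "(case z of (I, J) \<Rightarrow> opnorm (\<lambda>i j. A i j * X i j \<omega>) p q J I)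
      \<le> Q \<omega> * (H * (cR * sqrt R + cC * sqrt C))" by (simp add: z)
  qed
  \<comment> \<open>Integrability is required only of the nonnegative majorant: if the left
    integrand failed to be integrable, its integral would be 0 by convention.\<close>
  then have "expectation (\<lambda>\<omega>. SUP (I, J)\<in>\<II> \<times> \<JJ>. opnorm (\<lambda>i j. A i j * X i j \<omega>) p q J I)
      \<le> expectation (\<lambda>\<omega>. Q \<omega> * (H * (cR * sqrt R + cC * sqrt C)))"
    using Q H cRC RC0 by (intro integral_mono') auto
  also have "\<dots> = expectation Q * (H * (cR * sqrt R + cC * sqrt C))" by simp
  also have "\<dots> \<le> 1 * (H * (cR * sqrt R + cC * sqrt C))"
    using Q H cRC RC0 by (intro mult_right_mono) auto
  also have "\<dots> \<le> H * ((c0 + cR) * sqrt R + cC * sqrt C)"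
    using H c0 RC0 by (simp add: mult_left_mono mult_right_mono)
  finally show ?thesis
    using RC0 unfolding eq[symmetric] c0_def cR_def cC_def H_def R_def[symmetric] C_def[symmetric]
    by (simp add: powr_half_sqrt add.assoc)
qed

end
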